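(* Let $m,n\ge 2$, let $M$ be a nonempty compact set in $\mathbb{R}^m$, and let $K_1,\dots,K_m$ be nonempty compact sets in $\mathbb{R}^n$. Then $$V\left(\oplus_M(K_1,\dots,K_m)\right)^{1/n}\ge h_{\operatorname{conv}M}\left(V(K_1)^{1/n},\dots,V(K_m)^{1/n}\right).$$ If $V(K_j)>0$ for $j=1,\dots,m$, $M\cap F(\operatorname{conv}M,x)\not\subset\bigcup_{j=1}^m e_j^\perp$ for all $x\in(0,\infty)^m$, and equality holds in this inequality, then $K_1,\dots,K_m$ are homothetic convex bodies.
   Context: $V$ is $n$-dimensional Lebesgue measure. $h_K(x)=\sup\{x\cdot y:y\in K\}$ is the support function of $K$; for a compact convex set $K\subset\mathbb{R}^m$ and $x\ne o$, $F(K,x)=\{y\in K:x\cdot y=h_K(x)\}$ is the support set of $K$ with outer normal vector $x$. $e_1,\dots,e_m$ is the standard basis of $\mathbb{R}^m$ and $e_j^\perp$ is the coordinate hyperplane orthogonal to $e_j$. A convex body is a compact convex set with nonempty interior. The $M$-sum is $\oplus_M(K_1,\dots,K_m)=\left\{\sum_{j=1}^m a_jx^{(j)}:x^{(j)}\in K_j,\ (a_1,\dots,a_m)\in M\right\}$. *)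

theory Defs
  imports "HOL-Analysis.Analysis"
begin

definition M_sum :: "(real ^ 'm) set \<Rightarrow> ('m::finite \<Rightarrow> (real ^ 'n) set) \<Rightarrow> (real ^ 'n) set"
  where "M_sum M K = {(\<Sum>j\<in>UNIV. (a $ j) *\<^sub>R x j) | a x. a \<in> M \<and> (\<forall>j. x j \<in> K j)}"

(* The supremum is taken in the reals, so the value is meaningful only for nonempty sets
   on which the linear functional is bounded above, in particular for nonempty compact sets. *)
definition support_fun :: "'a::real_inner set \<Rightarrow> 'a \<Rightarrow> real"
  where "support_fun K x = (SUP y\<in>K. x \<bullet> y)"

definition support_set :: "'a::real_inner set \<Rightarrow> 'a \<Rightarrow> 'a set"
  where "support_set K x = {y \<in> K. x \<bullet> y = support_fun K x}"

definition coord_hyperplane :: "'m::finite \<Rightarrow> (real ^ 'm) set"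
  where "coord_hyperplane j = {y. axis j 1 \<bullet> y = 0}"

definition convex_body :: "'a::euclidean_space set \<Rightarrow> bool"
  where "convex_body K \<longleftrightarrow> compact K \<and> convex K \<and> interior K \<noteq> {}"

(* Homothety is understood with a positive ratio. *)
definition homothetic :: "'a::real_vector set \<Rightarrow> 'a set \<Rightarrow> bool"
  where "homothetic K L \<longleftrightarrow> (\<exists>r t. r > 0 \<and> L = (\<lambda>x. r *\<^sub>R x + t) ` K)"

definition vol_root :: "(real ^ 'n::finite) set \<Rightarrow> real"
  where "vol_root K = root CARD('n) (measure lebesgue K)"

end

theory Submission
  imports Defs
begin

text \<open>
  For a maximiser \<open>a\<close> of the linear functional over \<open>M\<close>, the \<open>M\<close>-sum contains \<open>\<Sum>\<^sub>j a\<^sub>j K\<^sub>j\<close>, so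
  everything follows from the Brunn-Minkowski inequality for compact sets and its equality case.
  In the equality case one may choose \<open>a\<close> without zero coordinates; comparing \<open>a\<^sub>j\<close> with
  \<open>\<bar>a\<^sub>j\<bar>\<close> then forces \<open>a\<^sub>j > 0\<close>, and equality for the whole sum forces it for every pair.

  The inequality is proved after Hadwiger and Ohmann, by cutting unions of boxes. For the equality
  case let \<open>A\<close>, \<open>B\<close> and \<open>\<alpha> A + \<beta> B\<close> have the same volume, \<open>\<alpha> + \<beta> = 1\<close>. Cutting \<open>A\<close> and \<open>B\<close> by
  parallel hyperplanes at \<^emph>\<open>different\<close> volume ratios and applying the inequality to the parts gives a
  first-order condition on the quantile functions of \<open>A\<close> and \<open>B\<close> in each direction, which makes
  them differ by a constant. By comparing centroids these constants are induced by one translation;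
  after it, \<open>A\<close> and \<open>B\<close> give the same measure to every halfspace, hence the same integral to every
  exponential, and so they agree up to a null set. The points of \<open>A\<close> all of whose
  neighbourhoods meet \<open>A\<close> in positive measure absorb \<open>\<alpha>\<close>-\<open>\<beta>\<close>-combinations with points of \<open>A\<close> and \<open>B\<close>;
  therefore they form a convex set, which is all of \<open>A\<close> and all of \<open>B\<close>.
\<close>

section \<open>Cutting by hyperplanes\<close>

lemma compact_set_plus:
  fixes A B :: "'a::real_normed_vector set"
  assumes "compact A" "compact B"
  shows "compact (A + B)"
proof -
  have "A + B = {x + y | x y. x \<in> A \<and> y \<in> B}"
    by (auto simp: set_plus_def)
  then show ?thesis
    using compact_sums[OF assms] by simp
qed

lemma compact_Int_halfspace:
  fixes A :: "'a::euclidean_space set"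
  assumes "compact A"
  shows "compact (A \<inter> {x. u \<bullet> x \<le> s})" "compact (A \<inter> {x. u \<bullet> x \<ge> s})"
  using assms closed_halfspace_le[of u s] closed_halfspace_ge[of s u]
  by (auto simp: compact_Int_closed)

text \<open>The overlap lies in the hyperplane at level \<open>s\<close>, which is null, so the two
  measures add up inside \<open>E\<close>.\<close>

lemma measure_Un_le_hyperplane:
  fixes C D E :: "'a::euclidean_space set"
  assumes "compact C" "compact D" "E \<in> lmeasurable" "C \<subseteq> E" "D \<subseteq> E" "u \<noteq> 0"
    and C: "\<And>x. x \<in> C \<Longrightarrow> u \<bullet> x \<le> s" and D: "\<And>x. x \<in> D \<Longrightarrow> s \<le> u \<bullet> x"
  shows "measure lebesgue C + measure lebesgue D \<le> measure lebesgue E"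
proof -
  have "C \<inter> D \<subseteq> {x. u \<bullet> x = s}"
    using C D by force
  then have "negligible (C \<inter> D)"
    using negligible_hyperplane[of u s] \<open>u \<noteq> 0\<close> negligible_subset by blast
  then have "measure lebesgue C + measure lebesgue D = measure lebesgue (C \<union> D)"
    using assms lmeasurable_compact
    by (subst measure_Un3) (auto simp: negligible_imp_measure0)
  also have "\<dots> \<le> measure lebesgue E"
    using assms by (intro measure_mono_fmeasurable) (auto dest: lmeasurable_compact)
  finally show ?thesis .
qed

lemma measure_halfspace_split:
  fixes A :: "'a::euclidean_space set"
  assumes "compact A" "u \<noteq> 0"
  shows "measure lebesgue (A \<inter> {x. u \<bullet> x \<le> s}) + measure lebesgue (A \<inter> {x. s \<le> u \<bullet> x})
    = measure lebesgue A"
proof -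
  have "A \<inter> {x. u \<bullet> x \<le> s} \<inter> (A \<inter> {x. s \<le> u \<bullet> x}) \<subseteq> {x. u \<bullet> x = s}"
    by force
  then have "negligible (A \<inter> {x. u \<bullet> x \<le> s} \<inter> (A \<inter> {x. s \<le> u \<bullet> x}))"
    using negligible_hyperplane[of u s] \<open>u \<noteq> 0\<close> negligible_subset by blast
  moreover have "A \<inter> {x. u \<bullet> x \<le> s} \<union> (A \<inter> {x. s \<le> u \<bullet> x}) = A"
    by auto
  ultimately show ?thesis
    using measure_Un3[of "A \<inter> {x. u \<bullet> x \<le> s}" lebesgue "A \<inter> {x. s \<le> u \<bullet> x}"]
    by (simp add: assms compact_Int_halfspace lmeasurable_compact negligible_imp_measure0)
qed

text \<open>Levels add under Minkowski addition, so the lower sum stays below \<open>s + t\<close>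
  and the upper one above \<open>s' + t'\<close>. The inequality is proved with
  \<open>s' = s\<close> and \<open>t' = t\<close>; the equality case cuts the lower and upper parts
  at different levels.\<close>

lemma measure_halfspace_cut_le:
  fixes A B :: "'a::euclidean_space set"
  assumes "compact A" "compact B" "u \<noteq> 0"
    and "compact A1" "compact A2" "compact B1" "compact B2"
    and "A1 \<subseteq> A \<inter> {x. u \<bullet> x \<le> s}" "B1 \<subseteq> B \<inter> {x. u \<bullet> x \<le> t}"
    and "A2 \<subseteq> A \<inter> {x. s' \<le> u \<bullet> x}" "B2 \<subseteq> B \<inter> {x. t' \<le> u \<bullet> x}"
    and "s + t \<le> s' + t'"
  shows "measure lebesgue (A1 + B1) + measure lebesgue (A2 + B2) \<le> measure lebesgue (A + B)"
proof (rule measure_Un_le_hyperplane[where u = u and s = "s + t"])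
  show "u \<bullet> x \<le> s + t" if "x \<in> A1 + B1" for x
    using that assms by (auto simp: set_plus_def inner_add_right subset_iff intro!: add_mono)
  show "s + t \<le> u \<bullet> x" if "x \<in> A2 + B2" for x
  proof -
    obtain a b where "x = a + b" "s' \<le> u \<bullet> a" "t' \<le> u \<bullet> b"
      using \<open>x \<in> A2 + B2\<close> assms(10,11) by (blast elim: set_plus_elim)
    then show ?thesis
      using assms by (simp add: inner_add_right)
  qed
  show "A1 + B1 \<subseteq> A + B" "A2 + B2 \<subseteq> A + B"
    using assms(8-11) by (intro set_plus_mono2; blast)+
qed (use assms in \<open>auto intro!: compact_set_plus lmeasurable_compact\<close>)

text \<open>Dominated convergence: off the null hyperplane at level \<open>s\<close> the indicators
  are eventually constant along any sequence of levels tending to \<open>s\<close>. Continuity is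
  what allows cuts of prescribed volume.\<close>

lemma continuous_measure_halfspace:
  fixes A :: "'a::euclidean_space set"
  assumes "compact A" "u \<noteq> 0"
  shows "continuous_on UNIV (\<lambda>s. measure lebesgue (A \<inter> {x. u \<bullet> x \<le> s}))"
  unfolding continuous_on_sequentially
proof safe
  fix X :: "nat \<Rightarrow> real" and s assume X: "X \<longlonglongrightarrow> s"
  have A: "A \<in> lmeasurable"
    using assms lmeasurable_compact by blast
  have m: "measure lebesgue (A \<inter> {x. u \<bullet> x \<le> r}) = (\<integral>x. indicator (A \<inter> {x. u \<bullet> x \<le> r}) x \<partial>lebesgue)" for r
    by simp
  have meas: "A \<inter> {x. u \<bullet> x \<le> r} \<in> lmeasurable" for r
    using assms compact_Int_halfspace(1) lmeasurable_compact by blast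
  have "(\<lambda>n. \<integral>x. indicat_real (A \<inter> {x. u \<bullet> x \<le> X n}) x \<partial>lebesgue)
      \<longlonglongrightarrow> (\<integral>x. indicat_real (A \<inter> {x. u \<bullet> x \<le> s}) x \<partial>lebesgue)"
  proof (rule integral_dominated_convergence[where w = "indicator A"])
    show "integrable lebesgue (indicat_real A)"
      using A lmeasurable_iff_integrable by blast
    have "AE x in lebesgue. u \<bullet> x \<noteq> s"
      using negligible_hyperplane[of u s] \<open>u \<noteq> 0\<close>
      by (auto simp: negligible_iff_null_sets intro: AE_I'[of "{x. u \<bullet> x = s}"])
    then show "AE x in lebesgue. (\<lambda>i. indicat_real (A \<inter> {x. u \<bullet> x \<le> X i}) x)
        \<longlonglongrightarrow> indicator (A \<inter> {x. u \<bullet> x \<le> s}) x"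
    proof eventually_elim
      case (elim x)
      then consider "u \<bullet> x < s" | "s < u \<bullet> x" by linarith
      then have "eventually (\<lambda>i. indicat_real (A \<inter> {x. u \<bullet> x \<le> X i}) x
          = indicator (A \<inter> {x. u \<bullet> x \<le> s}) x) sequentially"
      proof cases
        case 1
        show ?thesis
          using order_tendstoD(1)[OF X 1] by (rule eventually_mono) (use 1 in \<open>auto simp: indicator_def\<close>)
      next
        case 2
        show ?thesis
          using order_tendstoD(2)[OF X 2] by (rule eventually_mono) (use 2 in \<open>auto simp: indicator_def\<close>)
      qed
      then show ?case
        by (rule tendsto_eventually)
    qed
    next
    show "AE x in lebesgue. norm (indicat_real (A \<inter> {x. u \<bullet> x \<le> X i}) x) \<le> indicator A x" for i
      by (auto simp: indicator_def)
  qed (rule borel_measurable_indicator[OF fmeasurableD[OF meas]])+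
  then show "((\<lambda>s. measure lebesgue (A \<inter> {x. u \<bullet> x \<le> s})) \<circ> X)
      \<longlonglongrightarrow> measure lebesgue (A \<inter> {x. u \<bullet> x \<le> s})"
    by (simp add: o_def)
qed

lemma halfspace_quantile_ex:
  fixes A :: "'a::euclidean_space set"
  assumes "compact A" "u \<noteq> 0" "0 \<le> v" "v \<le> measure lebesgue A" "0 \<le> R"
    and b: "\<And>x. x \<in> A \<Longrightarrow> \<bar>u \<bullet> x\<bar> \<le> R"
  obtains s where "-R - 1 \<le> s" "s \<le> R + 1" "measure lebesgue (A \<inter> {x. u \<bullet> x \<le> s}) = v"
proof -
  \<comment> \<open>The margin 1 makes the lowest cut empty even if \<open>A\<close> touches the
    level \<open>-R\<close>.\<close>
  have "A \<inter> {x. u \<bullet> x \<le> -R-1} = {}" "A \<inter> {x. u \<bullet> x \<le> R+1} = A"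
    using b by force+
  then show ?thesis
    using IVT'[of "\<lambda>s. measure lebesgue (A \<inter> {x. u \<bullet> x \<le> s})" "-R-1" v "R+1"] that
      continuous_on_subset[OF continuous_measure_halfspace[OF assms(1,2)]] assms(3,4) \<open>0 \<le> R\<close>
    by auto
qed

section \<open>The Brunn-Minkowski inequality\<close>

abbreviation vroot :: "'a::euclidean_space set \<Rightarrow> real"
  where "vroot S \<equiv> root DIM('a) (measure lebesgue S)"

lemma vroot_power: "vroot (S::'a::euclidean_space set) ^ DIM('a) = measure lebesgue S"
  by (simp add: real_root_pow_pos2)

text \<open>After division by the right-hand side this is AM-GM for the ratios
  \<open>p i / (p i + q i)\<close> and \<open>q i / (p i + q i)\<close>, whose arithmetic means add
  up to 1.\<close>

lemma root_prod_add_le: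
  fixes p q :: "'i \<Rightarrow> real"
  assumes "finite S" "S \<noteq> {}" and pq: "\<And>i. i \<in> S \<Longrightarrow> 0 < p i" "\<And>i. i \<in> S \<Longrightarrow> 0 < q i"
  shows "root (card S) (\<Prod>i\<in>S. p i) + root (card S) (\<Prod>i\<in>S. q i) \<le> root (card S) (\<Prod>i\<in>S. p i + q i)"
proof -
  let ?n = "card S"
  have n: "?n > 0"
    using assms by (simp add: card_gt_0_iff)
  have amgm: "root ?n (\<Prod>i\<in>S. r i / (p i + q i)) \<le> (\<Sum>i\<in>S. r i / (p i + q i) / ?n)"
    if "\<And>i. i \<in> S \<Longrightarrow> 0 < r i" for r
  proof -
    have "0 < (\<Prod>i\<in>S. r i / (p i + q i))"
      using that pq by (intro prod_pos) (auto intro!: divide_pos_pos add_pos_pos)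
    then show ?thesis
      using arith_geom_mean[of S "\<lambda>i. r i / (p i + q i)"] assms n that
      by (simp add: root_powr_inverse add_nonneg_nonneg less_imp_le)
  qed
  have P: "0 < (\<Prod>i\<in>S. p i + q i)"
    using pq by (intro prod_pos) (simp add: add_pos_pos)
  have "root ?n (\<Prod>i\<in>S. p i / (p i + q i)) + root ?n (\<Prod>i\<in>S. q i / (p i + q i))
      \<le> (\<Sum>i\<in>S. p i / (p i + q i) / ?n) + (\<Sum>i\<in>S. q i / (p i + q i) / ?n)"
    using amgm[of p] amgm[of q] pq by (intro add_mono) auto
  also have "\<dots> = (\<Sum>i\<in>S. 1 / ?n)"
    unfolding sum.distrib[symmetric]
    using pq by (intro sum.cong refl) (simp add: add_divide_distrib[symmetric] add_pos_pos less_imp_neq[symmetric])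
  also have "\<dots> = 1"
    using n by simp
  finally have "(root ?n (prod p S) + root ?n (prod q S)) / root ?n (\<Prod>i\<in>S. p i + q i) \<le> 1"
    by (simp add: prod_dividef real_root_divide add_divide_distrib)
  then show ?thesis
    using P n by (simp add: divide_le_eq_1 real_root_gt_zero)
qed

text \<open>The sum contains a box whose side lengths are the sums of the given side lengths, so
  \<open>root_prod_add_le\<close> applies to the volumes.\<close>

lemma brunn_minkowski_cbox:
  fixes a b c d :: "'a::euclidean_space"
  assumes "box a b \<noteq> {}" "box c d \<noteq> {}"
  shows "vroot (cbox a b) + vroot (cbox c d) \<le> vroot (cbox a b + cbox c d)"
proof -
  have lt: "\<And>i. i \<in> Basis \<Longrightarrow> a \<bullet> i < b \<bullet> i" "\<And>i. i \<in> Basis \<Longrightarrow> c \<bullet> i < d \<bullet> i"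
    using assms by (auto simp: box_ne_empty)
  have sub: "cbox (a + c) (b + d) \<subseteq> cbox a b + cbox c d"
  proof
    fix x assume x: "x \<in> cbox (a + c) (b + d)"
    \<comment> \<open>In each coordinate the first summand has the lower bounds
      \<open>a \<bullet> i\<close> and \<open>x \<bullet> i - d \<bullet> i\<close>; their maximum
      is the least admissible value.\<close>
    define y where "y = (\<Sum>i\<in>Basis. max (a \<bullet> i) (x \<bullet> i - d \<bullet> i) *\<^sub>R i)"
    have "y \<in> cbox a b" "x - y \<in> cbox c d"
      using x lt unfolding y_def mem_box by (fastforce simp: inner_add_left inner_diff_left)+
    then show "x \<in> cbox a b + cbox c d"
      using set_plus_intro[of y "cbox a b" "x - y" "cbox c d"] by simp
  qed
  have m: "measure lebesgue (cbox u v) = (\<Prod>i\<in>Basis. v \<bullet> i - u \<bullet> i)"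
    if "\<And>i. i \<in> Basis \<Longrightarrow> u \<bullet> i < v \<bullet> i" for u v :: 'a
    using that content_cbox[of u v] by (simp add: less_imp_le)
  have "vroot (cbox a b) + vroot (cbox c d)
      \<le> root DIM('a) (\<Prod>i\<in>Basis. (b \<bullet> i - a \<bullet> i) + (d \<bullet> i - c \<bullet> i))"
    using root_prod_add_le[of "Basis :: 'a set" "\<lambda>i. b \<bullet> i - a \<bullet> i" "\<lambda>i. d \<bullet> i - c \<bullet> i"]
      m[of a b] m[of c d] lt by simp
  also have "\<dots> = vroot (cbox (a + c) (b + d))"
    using lt by (subst m) (auto simp: inner_add_left add_strict_mono algebra_simps)
  also have "\<dots> \<le> vroot (cbox a b + cbox c d)"
    by (intro real_root_le_mono measure_mono_fmeasurable[OF sub] lmeasurable_compact compact_set_plus)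
      auto
  finally show ?thesis .
qed

section \<open>Finite unions of boxes and the passage to compact sets\<close>

lemma box_nonempty_if_content_pos:
  "0 < measure lebesgue (cbox a b) \<Longrightarrow> box a b \<noteq> {}"
  using content_pos_lt_eq[of a b] by (simp add: box_ne_empty)

text \<open>Positive volume gives every member a non-empty interior, so two distinct members are
  separated by a hyperplane orthogonal to a basis vector. The induction cuts along such
  hyperplanes.\<close>

definition box_family :: "'a::euclidean_space set set \<Rightarrow> bool"
  where "box_family \<D> \<longleftrightarrow> finite \<D> \<and> \<D> \<noteq> {}
    \<and> (\<forall>D\<in>\<D>. (\<exists>a b. D = cbox a b) \<and> 0 < measure lebesgue D)
    \<and> pairwise (\<lambda>D E. interior D \<inter> interior E = {}) \<D>"

lemma box_family_compact: "box_family \<D> \<Longrightarrow> compact (\<Union>\<D>)"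
  unfolding box_family_def by (auto intro!: compact_Union)

text \<open>Members that meet \<open>H\<close> in a null set are dropped. This keeps the remaining
  volumes positive, costs no measure, and is the reason why a cut can reduce the number of
  boxes.\<close>

lemma box_family_Int:
  fixes \<D> :: "'a::euclidean_space set set"
  assumes \<D>: "box_family \<D>" and pos: "0 < measure lebesgue (\<Union>\<D> \<inter> H)" and "closed H"
    and H: "\<And>a b. \<exists>c d. cbox a b \<inter> H = cbox c d"
  obtains \<D>' where "box_family \<D>'" "card \<D>' \<le> card {D \<in> \<D>. 0 < measure lebesgue (D \<inter> H)}"
    "\<Union>\<D>' \<subseteq> \<Union>\<D> \<inter> H" "measure lebesgue (\<Union>\<D>') = measure lebesgue (\<Union>\<D> \<inter> H)"
proof
  define \<E> where "\<E> = {D \<in> \<D>. 0 < measure lebesgue (D \<inter> H)}"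
  define \<D>' where "\<D>' = (\<lambda>D. D \<inter> H) ` \<E>"
  have fin: "finite \<D>" "finite \<E>"
    using \<D> by (auto simp: box_family_def \<E>_def)
  have comp: "compact (D \<inter> H)" if "D \<in> \<D>" for D
    using \<D> that \<open>closed H\<close> by (auto simp: box_family_def compact_Int_closed)
  show "card \<D>' \<le> card {D \<in> \<D>. 0 < measure lebesgue (D \<inter> H)}"
    unfolding \<D>'_def \<E>_def[symmetric] by (rule card_image_le[OF fin(2)])
  show sub: "\<Union>\<D>' \<subseteq> \<Union>\<D> \<inter> H"
    by (auto simp: \<D>'_def \<E>_def)
  define N where "N = \<Union>((\<lambda>D. D \<inter> H) ` (\<D> - \<E>))"
  have "negligible N"
    unfolding N_def
  proof (rule negligible_Union)
    fix T assume "T \<in> (\<lambda>D. D \<inter> H) ` (\<D> - \<E>)"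
    then obtain D where D: "T = D \<inter> H" "D \<in> \<D>" "\<not> 0 < measure lebesgue (D \<inter> H)"
      by (auto simp: \<E>_def)
    then have "measure lebesgue (D \<inter> H) = 0"
      using measure_nonneg[of lebesgue "D \<inter> H"] by linarith
    then show "negligible T"
      using D comp[OF D(2)] by (simp add: lmeasurable_compact negligible_iff_measure)
  qed (use fin in auto)
  moreover have "\<Union>\<D> \<inter> H = \<Union>\<D>' \<union> N"
    by (auto simp: \<D>'_def N_def \<E>_def)
  moreover have "\<Union>\<D>' \<in> lmeasurable"
    unfolding \<D>'_def using fin comp
    by (intro lmeasurable_compact compact_Union) (auto simp: \<E>_def)
  ultimately show eq: "measure lebesgue (\<Union>\<D>') = measure lebesgue (\<Union>\<D> \<inter> H)"
    by (metis measure_Un_null_set negligible_iff_null_sets fmeasurableD)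
  show "box_family \<D>'"
    unfolding box_family_def
  proof (intro conjI ballI)
    show "finite \<D>'"
      using fin by (simp add: \<D>'_def)
    show "\<D>' \<noteq> {}"
      using pos eq by auto
    show "\<exists>a b. D = cbox a b" "0 < measure lebesgue D" if "D \<in> \<D>'" for D
      using that \<D> H by (auto simp: \<D>'_def \<E>_def box_family_def)
    show "pairwise (\<lambda>D E. interior D \<inter> interior E = {}) \<D>'"
      unfolding pairwise_def
    proof (intro ballI impI)
      fix X Y assume "X \<in> \<D>'" "Y \<in> \<D>'" "X \<noteq> Y"
      then obtain D E where "D \<in> \<D>" "E \<in> \<D>" "X = D \<inter> H" "Y = E \<inter> H" "D \<noteq> E"
        by (auto simp: \<D>'_def \<E>_def)
      moreover from this have "interior D \<inter> interior E = {}"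
        using \<D> by (simp add: box_family_def pairwise_def)
      ultimately show "interior X \<inter> interior Y = {}"
        by auto
    qed
  qed
qed

lemma cbox_Int_halfspace:
  fixes k :: "'a::euclidean_space"
  assumes "k \<in> Basis"
  shows "\<exists>c d. cbox a b \<inter> {x. k \<bullet> x \<le> s} = cbox c d" "\<exists>c d. cbox a b \<inter> {x. s \<le> k \<bullet> x} = cbox c d"
  using interval_split[OF assms, of a b s] by (auto simp: inner_commute)

text \<open>With a common ratio both roots on one side scale by the same factor. The bounds for the
  two sides are therefore \<open>\<theta>\<close> and \<open>1 - \<theta>\<close> times
  \<open>(vroot A + vroot B) ^ DIM('a)\<close> and add up to the bound for the whole.\<close>

lemma brunn_minkowski_proportional_cut:
  fixes A B :: "'a::euclidean_space set"
  assumes "compact A" "compact B" "u \<noteq> 0" "0 < \<theta>" "\<theta> < 1"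
    and "compact A1" "compact A2" "compact B1" "compact B2"
    and "A1 \<subseteq> A \<inter> {x. u \<bullet> x \<le> s}" "B1 \<subseteq> B \<inter> {x. u \<bullet> x \<le> t}"
    and "A2 \<subseteq> A \<inter> {x. s \<le> u \<bullet> x}" "B2 \<subseteq> B \<inter> {x. t \<le> u \<bullet> x}"
    and m: "measure lebesgue A1 = \<theta> * measure lebesgue A" "measure lebesgue B1 = \<theta> * measure lebesgue B"
      "measure lebesgue A2 = (1 - \<theta>) * measure lebesgue A" "measure lebesgue B2 = (1 - \<theta>) * measure lebesgue B"
    and bm: "vroot A1 + vroot B1 \<le> vroot (A1 + B1)" "vroot A2 + vroot B2 \<le> vroot (A2 + B2)"
  shows "vroot A + vroot B \<le> vroot (A + B)"
proof -
  let ?n = "DIM('a)"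
  have piece: "\<rho> * (vroot A + vroot B) ^ ?n \<le> measure lebesgue (A' + B')"
    if "vroot A' + vroot B' \<le> vroot (A' + B')" "0 \<le> \<rho>"
      "measure lebesgue A' = \<rho> * measure lebesgue A" "measure lebesgue B' = \<rho> * measure lebesgue B"
    for A' B' :: "'a set" and \<rho>
  proof -
    have "\<rho> * (vroot A + vroot B) ^ ?n = (vroot A' + vroot B') ^ ?n"
      using that by (simp add: real_root_mult distrib_left[symmetric] power_mult_distrib real_root_pow_pos2)
    also have "\<dots> \<le> vroot (A' + B') ^ ?n"
      using that by (intro power_mono) auto
    finally show ?thesis
      by (simp add: vroot_power)
  qed
  have "(vroot A + vroot B) ^ ?n = \<theta> * (vroot A + vroot B) ^ ?n + (1 - \<theta>) * (vroot A + vroot B) ^ ?n"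
    by (simp add: algebra_simps)
  also have "\<dots> \<le> measure lebesgue (A1 + B1) + measure lebesgue (A2 + B2)"
    using assms by (intro add_mono piece) auto
  also have "\<dots> \<le> measure lebesgue (A + B)"
    using assms by (intro measure_halfspace_cut_le[where u = u and s = s and t = t and s' = s and t' = t]) auto
  finally have "root ?n ((vroot A + vroot B) ^ ?n) \<le> vroot (A + B)"
    by simp
  then show ?thesis
    by (simp add: real_root_power_cancel)
qed

text \<open>A hyperplane separating two boxes of the first family leaves fewer boxes of it on either
  side. The second family is cut by a parallel hyperplane in the same volume ratio, with no more
  boxes on either side than before, so the induction hypothesis covers both sides.\<close>

lemma brunn_minkowski_box_family_step:
  fixes \<D> \<E> :: "'a::euclidean_space set set"
  assumes \<D>: "box_family \<D>" and \<E>: "box_family \<E>" and "card \<D> \<ge> 2"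
    and IH: "\<And>\<D>' \<E>' :: 'a set set. box_family \<D>' \<Longrightarrow> box_family \<E>' \<Longrightarrow> card \<D>' + card \<E>' < card \<D> + card \<E> \<Longrightarrow>
      vroot (\<Union>\<D>') + vroot (\<Union>\<E>') \<le> vroot (\<Union>\<D>' + \<Union>\<E>')"
  shows "vroot (\<Union>\<D>) + vroot (\<Union>\<E>) \<le> vroot (\<Union>\<D> + \<Union>\<E>)"
proof -
  let ?\<mu> = "measure (lebesgue :: 'a measure)"
  have fin: "finite \<D>" "finite \<E>"
    using \<D> \<E> by (auto simp: box_family_def)
  obtain k D1 D2 s where k: "k \<in> Basis" and D12: "D1 \<in> \<D>" "D2 \<in> \<D>"
      "D1 \<subseteq> {x. k \<bullet> x \<le> s}" "D2 \<subseteq> {x. s \<le> k \<bullet> x}"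
  proof -
    obtain D E where DE: "D \<in> \<D>" "E \<in> \<D>" "D \<noteq> E"
      using \<open>card \<D> \<ge> 2\<close> by (metis card_2_iff' card_le_Suc0_iff_eq fin(1) not_less_eq_eq numeral_2_eq_2)
    then obtain a b c d where ab: "D = cbox a b" "E = cbox c d"
      using \<D> unfolding box_family_def by meson
    have "box a b \<inter> box c d = {}"
      using \<D> DE ab unfolding box_family_def pairwise_def by (metis interior_cbox)
    moreover have "box a b \<noteq> {}" "box c d \<noteq> {}"
      using \<D> DE ab by (auto simp: box_family_def intro!: box_nonempty_if_content_pos)
    \<comment> \<open>Disjoint non-empty open boxes are separated in some coordinate.\<close>
    ultimately obtain i where "i \<in> Basis" "b \<bullet> i \<le> c \<bullet> i \<or> d \<bullet> i \<le> a \<bullet> i"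
      unfolding disjoint_interval by (force simp: box_ne_empty)
    moreover have "cbox u v \<subseteq> {x. i \<bullet> x \<le> v \<bullet> i}" "cbox u v \<subseteq> {x. u \<bullet> i \<le> i \<bullet> x}"
      if "i \<in> Basis" for i u v :: 'a
      using that by (auto simp: mem_box inner_commute)
    moreover have "{x. c \<bullet> i \<le> i \<bullet> x} \<subseteq> {x. b \<bullet> i \<le> i \<bullet> x}" if "b \<bullet> i \<le> c \<bullet> i" for i b c :: 'a
      using that by auto
    ultimately show ?thesis
      using that[of i D E "b \<bullet> i"] that[of i E D "d \<bullet> i"] DE(1,2) unfolding ab
      by (meson order_trans)
  qed
  define A B where "A = \<Union>\<D>" and "B = \<Union>\<E>"
  define H1 H2 where "H1 = {x. k \<bullet> x \<le> s}" and "H2 = {x. s \<le> k \<bullet> x}"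
  have "k \<noteq> 0"
    using k by auto
  have comp: "compact A" "compact B"
    using \<D> \<E> by (auto simp: A_def B_def box_family_compact)
  have cl: "closed H1" "closed H2"
    by (auto simp: H1_def H2_def closed_halfspace_le closed_halfspace_ge)
  have compA: "compact (A \<inter> H1)" "compact (A \<inter> H2)"
    using comp cl by (auto simp: compact_Int_closed)
  have posD: "0 < ?\<mu> D" "compact D" if "D \<in> \<D>" for D
    using that \<D> by (auto simp: box_family_def)
  have posE: "0 < ?\<mu> D" "compact D" if "D \<in> \<E>" for D
    using that \<E> by (auto simp: box_family_def)
  have "?\<mu> D1 \<le> ?\<mu> (A \<inter> H1)" "?\<mu> D2 \<le> ?\<mu> (A \<inter> H2)"
    using D12 posD compA
    by (auto simp: A_def H1_def H2_def intro!: measure_mono_fmeasurable lmeasurable_compact fmeasurableD)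
  then have pos: "0 < ?\<mu> (A \<inter> H1)" "0 < ?\<mu> (A \<inter> H2)"
    using posD D12 by fastforce+
  have split: "?\<mu> (A \<inter> H1) + ?\<mu> (A \<inter> H2) = ?\<mu> A"
    unfolding H1_def H2_def by (rule measure_halfspace_split[OF comp(1) \<open>k \<noteq> 0\<close>])
  \<comment> \<open>\<open>D1\<close> disappears from the upper part and \<open>D2\<close> from the
    lower one, which makes the box count drop strictly.\<close>
  have neg: "D1 \<inter> H2 \<subseteq> {x. k \<bullet> x = s}" "D2 \<inter> H1 \<subseteq> {x. k \<bullet> x = s}"
    using D12 by (auto simp: H1_def H2_def)
  then have "negligible (D1 \<inter> H2)" "negligible (D2 \<inter> H1)"
    using negligible_hyperplane[of k s] \<open>k \<noteq> 0\<close> negligible_subset by blast+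
  then have null: "?\<mu> (D1 \<inter> H2) = 0" "?\<mu> (D2 \<inter> H1) = 0"
    by (simp_all add: negligible_imp_measure0)
  have "D2 \<notin> {D \<in> \<D>. 0 < ?\<mu> (D \<inter> H1)}" "D1 \<notin> {D \<in> \<D>. 0 < ?\<mu> (D \<inter> H2)}"
    by (simp_all add: null)
  then have "{D \<in> \<D>. 0 < ?\<mu> (D \<inter> H1)} \<subset> \<D>" "{D \<in> \<D>. 0 < ?\<mu> (D \<inter> H2)} \<subset> \<D>"
    using D12(1,2) by blast+
  then have less: "card {D \<in> \<D>. 0 < ?\<mu> (D \<inter> H1)} < card \<D>" "card {D \<in> \<D>. 0 < ?\<mu> (D \<inter> H2)} < card \<D>"
    by (simp_all only: psubset_card_mono[OF fin(1)])
  have cut: "(\<And>\<D>'. box_family \<D>' \<Longrightarrow> card \<D>' < card \<D> \<Longrightarrow> \<Union>\<D>' \<subseteq> A \<inter> H \<Longrightarrow> ?\<mu> (\<Union>\<D>') = ?\<mu> (A \<inter> H) \<Longrightarrow> thesis) \<Longrightarrow> thesis"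
    if "H = H1 \<or> H = H2" for H thesis
  proof -
    assume *: "\<And>\<D>'. box_family \<D>' \<Longrightarrow> card \<D>' < card \<D> \<Longrightarrow> \<Union>\<D>' \<subseteq> A \<inter> H \<Longrightarrow> ?\<mu> (\<Union>\<D>') = ?\<mu> (A \<inter> H) \<Longrightarrow> thesis"
    show thesis
    proof (rule box_family_Int[OF \<D>, of H])
      show "\<exists>c d. cbox a b \<inter> H = cbox c d" for a b
        using that cbox_Int_halfspace[OF k] by (auto simp: H1_def H2_def)
      fix \<D>' assume "box_family \<D>'" "card \<D>' \<le> card {D \<in> \<D>. 0 < ?\<mu> (D \<inter> H)}"
        "\<Union>\<D>' \<subseteq> \<Union>\<D> \<inter> H" "?\<mu> (\<Union>\<D>') = ?\<mu> (\<Union>\<D> \<inter> H)"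
      then show thesis
        using that less by (intro *[of \<D>']) (auto simp: A_def)
    qed (use that pos cl in \<open>auto simp: A_def\<close>)
  qed
  obtain \<D>1 where \<D>1: "box_family \<D>1" "card \<D>1 < card \<D>" "\<Union>\<D>1 \<subseteq> A \<inter> H1" "?\<mu> (\<Union>\<D>1) = ?\<mu> (A \<inter> H1)"
    using cut[of H1] by blast
  obtain \<D>2 where \<D>2: "box_family \<D>2" "card \<D>2 < card \<D>" "\<Union>\<D>2 \<subseteq> A \<inter> H2" "?\<mu> (\<Union>\<D>2) = ?\<mu> (A \<inter> H2)"
    using cut[of H2] by blast
  define \<theta> where "\<theta> = ?\<mu> (A \<inter> H1) / ?\<mu> A"
  have \<theta>1: "0 < \<theta>" "\<theta> < 1" "?\<mu> (A \<inter> H1) = \<theta> * ?\<mu> A"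
    using pos split by (auto simp: \<theta>_def)
  then have "?\<mu> (A \<inter> H2) = (1 - \<theta>) * ?\<mu> A"
    using split by (simp add: left_diff_distrib)
  note \<theta> = \<theta>1 this
  obtain E where "E \<in> \<E>"
    using \<E> by (auto simp: box_family_def)
  then have "?\<mu> E \<le> ?\<mu> B"
    using comp posE unfolding B_def
    by (intro measure_mono_fmeasurable) (auto intro!: lmeasurable_compact fmeasurableD)
  then have posB: "0 < ?\<mu> B"
    using posE[OF \<open>E \<in> \<E>\<close>] by linarith
  obtain R where "0 \<le> R" "\<And>x. x \<in> B \<Longrightarrow> \<bar>k \<bullet> x\<bar> \<le> R"
  proof -
    obtain R where "\<And>x. x \<in> B \<Longrightarrow> norm x \<le> R" "0 < R"
      using comp(2) compact_imp_bounded bounded_pos by metis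
    moreover have "\<bar>k \<bullet> x\<bar> \<le> norm x" for x
      using Basis_le_norm[OF k, of x] by (simp add: inner_commute)
    ultimately show ?thesis
      using that[of R] by (meson less_imp_le order_trans)
  qed
  moreover have "0 \<le> \<theta> * ?\<mu> B" "\<theta> * ?\<mu> B \<le> ?\<mu> B"
    using \<theta> by (auto intro: mult_left_le_one_le)
  \<comment> \<open>Only the volume ratio has to match; the level \<open>t\<close> is not tied to
    \<open>s\<close>.\<close>
  ultimately obtain t where t: "?\<mu> (B \<inter> {x. k \<bullet> x \<le> t}) = \<theta> * ?\<mu> B"
    using halfspace_quantile_ex[OF comp(2) \<open>k \<noteq> 0\<close>] by metis
  then have t': "?\<mu> (B \<inter> {x. t \<le> k \<bullet> x}) = (1 - \<theta>) * ?\<mu> B"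
    using measure_halfspace_split[OF comp(2) \<open>k \<noteq> 0\<close>, of t] by (simp add: algebra_simps)
  have le: "card {D \<in> \<E>. 0 < ?\<mu> (D \<inter> H)} \<le> card \<E>" for H
    using fin by (intro card_mono) auto
  have tpos: "0 < \<theta> * ?\<mu> B" "0 < (1 - \<theta>) * ?\<mu> B"
    using \<theta> posB by auto
  obtain \<E>1 where \<E>1: "box_family \<E>1" "card \<E>1 \<le> card \<E>" "\<Union>\<E>1 \<subseteq> B \<inter> {x. k \<bullet> x \<le> t}" "?\<mu> (\<Union>\<E>1) = \<theta> * ?\<mu> B"
  proof (rule box_family_Int[OF \<E>, of "{x. k \<bullet> x \<le> t}"])
    show "0 < ?\<mu> (\<Union>\<E> \<inter> {x. k \<bullet> x \<le> t})"
      using tpos(1) t by (simp add: B_def)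
  qed (use cbox_Int_halfspace[OF k] t closed_halfspace_le[of k t] in \<open>auto simp: B_def intro: order_trans[OF _ le]\<close>)
  obtain \<E>2 where \<E>2: "box_family \<E>2" "card \<E>2 \<le> card \<E>" "\<Union>\<E>2 \<subseteq> B \<inter> {x. t \<le> k \<bullet> x}" "?\<mu> (\<Union>\<E>2) = (1 - \<theta>) * ?\<mu> B"
  proof (rule box_family_Int[OF \<E>, of "{x. t \<le> k \<bullet> x}"])
    show "0 < ?\<mu> (\<Union>\<E> \<inter> {x. t \<le> k \<bullet> x})"
      using tpos(2) t' by (simp add: B_def)
  qed (use cbox_Int_halfspace[OF k] t' closed_halfspace_ge[of t k] in \<open>auto simp: B_def intro: order_trans[OF _ le]\<close>)
  have "vroot A + vroot B \<le> vroot (A + B)"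
  proof (rule brunn_minkowski_proportional_cut[where u = k and s = s and t = t and \<theta> = \<theta>
        and ?A1.0 = "\<Union>\<D>1" and ?A2.0 = "\<Union>\<D>2" and ?B1.0 = "\<Union>\<E>1" and ?B2.0 = "\<Union>\<E>2"])
    show "vroot (\<Union>\<D>1) + vroot (\<Union>\<E>1) \<le> vroot (\<Union>\<D>1 + \<Union>\<E>1)"
      using \<D>1 \<E>1 by (intro IH) auto
    show "vroot (\<Union>\<D>2) + vroot (\<Union>\<E>2) \<le> vroot (\<Union>\<D>2 + \<Union>\<E>2)"
      using \<D>2 \<E>2 by (intro IH) auto
  qed (use \<D>1 \<D>2 \<E>1 \<E>2 \<theta> comp \<open>k \<noteq> 0\<close> in \<open>auto simp: box_family_compact H1_def[symmetric] H2_def[symmetric]\<close>)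
  then show ?thesis
    by (simp add: A_def B_def)
qed

text \<open>Induction on the total number of boxes. A family with at least two boxes is cut, with
  the roles exchanged if it is the second one; two single boxes are the base case.\<close>

lemma brunn_minkowski_box_family:
  fixes \<D> \<E> :: "'a::euclidean_space set set"
  assumes "box_family \<D>" "box_family \<E>"
  shows "vroot (\<Union>\<D>) + vroot (\<Union>\<E>) \<le> vroot (\<Union>\<D> + \<Union>\<E>)"
  using assms
proof (induction "card \<D> + card \<E>" arbitrary: \<D> \<E> rule: less_induct)
  case less
  have "0 < card \<D>" "0 < card \<E>"
    using less.prems by (auto simp: box_family_def card_gt_0_iff)
  then consider "card \<D> \<ge> 2" | "card \<E> \<ge> 2" | "card \<D> = 1" "card \<E> = 1"
    by linarith
  then show ?case
  proof cases
    case 1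
    then show ?thesis
      using brunn_minkowski_box_family_step less by metis
  next
    case 2
    have "vroot (\<Union>\<E>) + vroot (\<Union>\<D>) \<le> vroot (\<Union>\<E> + \<Union>\<D>)"
      by (rule brunn_minkowski_box_family_step) (use 2 less in auto)
    then show ?thesis
      by (simp add: add.commute)
  next
    case 3
    then obtain D E where "\<D> = {D}" "\<E> = {E}"
      by (auto simp: card_1_singleton_iff)
    moreover from this less.prems obtain a b c d where "D = cbox a b" "E = cbox c d"
      by (auto simp: box_family_def)
    moreover have "box a b \<noteq> {}" "box c d \<noteq> {}"
      using less.prems calculation by (auto simp: box_family_def intro!: box_nonempty_if_content_pos)
    ultimately show ?thesis
      using brunn_minkowski_cbox by simp
  qed
qed

text \<open>A compact set is the intersection of its neighbourhoods \<open>S n\<close>, so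
  continuity of measure from above applies.\<close>

lemma compact_measure_outer:
  fixes C :: "'a::euclidean_space set"
  assumes "compact C" "C \<noteq> {}" "0 < e"
  obtains r where "0 < r" "measure lebesgue (C + cball 0 r) < measure lebesgue C + e"
proof -
  define S where "S n = C + cball (0::'a) (1 / Suc n)" for n
  have comp: "compact (S n)" for n
    unfolding S_def by (intro compact_set_plus assms compact_cball)
  have "decseq S"
    unfolding S_def decseq_def
    by (intro allI impI set_plus_mono2 subset_cball order_refl) (simp add: frac_le)
  have "(\<Inter>n. S n) = C"
  proof (intro equalityI subsetI INT_I)
    fix x assume x: "x \<in> (\<Inter>n. S n)"
    have "infdist x C \<le> 1 / Suc n" for n
    proof -
      obtain y z where "x = y + z" "y \<in> C" "norm z \<le> 1 / Suc n"
        using x unfolding S_def by (metis INT_E UNIV_I mem_cball_0 set_plus_elim)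
      then show ?thesis
        using infdist_le2[of y C x "1 / Suc n"] by (simp add: dist_norm)
    qed
    then have "infdist x C \<le> 0"
      using LIMSEQ_le_const[OF LIMSEQ_inverse_real_of_nat, of "infdist x C"]
      by (auto simp: inverse_eq_divide)
    then have "infdist x C = 0"
      using infdist_nonneg[of x C] by linarith
    then show "x \<in> C"
      using in_closed_iff_infdist_zero[of C x] assms compact_imp_closed by blast
  next
    fix x n assume "x \<in> C"
    then show "x \<in> S n"
      using set_plus_intro[of x C 0 "cball 0 (1 / Suc n)"] by (simp add: S_def)
  qed
  moreover have "(\<lambda>n. measure lebesgue (S n)) \<longlonglongrightarrow> measure lebesgue (\<Inter>n. S n)"
    using \<open>decseq S\<close> lmeasurable_compact[OF comp]
    by (intro Lim_measure_decseq) (auto simp: fmeasurableD fmeasurableD2 simp del: emeasure_completion)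
  ultimately have "eventually (\<lambda>n. measure lebesgue (S n) < measure lebesgue C + e) sequentially"
    using \<open>0 < e\<close> by (intro order_tendstoD) auto
  then obtain n where "measure lebesgue (S n) < measure lebesgue C + e"
    by (auto simp: eventually_sequentially)
  then show ?thesis
    using that[of "1 / Suc n"] by (simp add: S_def)
qed

text \<open>A fine division of a box around \<open>A\<close> is thinned to the cells that meet
  \<open>A\<close> and have positive volume; the degenerate cells form a null set.\<close>

lemma box_family_outer:
  fixes A :: "'a::euclidean_space set"
  assumes "compact A" "0 < measure lebesgue A" "0 < e"
  obtains \<D> where "box_family \<D>" "measure lebesgue A \<le> measure lebesgue (\<Union>\<D>)" "\<Union>\<D> \<subseteq> A + cball 0 e"
proof -
  obtain a b where ab: "A \<subseteq> cbox a b"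
    using bounded_subset_cbox_symmetric[OF compact_imp_bounded[OF assms(1)]] by metis
  \<comment> \<open>A cell inside a ball of radius \<open>e/2\<close> has all its points at mutual
    distance less than \<open>e\<close>.\<close>
  have "gauge (\<lambda>x::'a. ball x (e/2))"
    using \<open>0 < e\<close> by (auto simp: gauge_def)
  then obtain p where p: "p tagged_division_of (cbox a b)" "(\<lambda>x. ball x (e/2)) fine p"
    using fine_division_exists by blast
  have div: "snd ` p division_of (cbox a b)"
    by (rule division_of_tagged_division[OF p(1)])
  define \<D> where "\<D> = {D \<in> snd ` p. D \<inter> A \<noteq> {} \<and> 0 < measure lebesgue D}"
  have fin: "finite \<D>" "finite (snd ` p)"
    using division_ofD(1)[OF div] by (simp_all add: \<D>_def)
  have boxes: "\<exists>a b. D = cbox a b" if "D \<in> snd ` p" for D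
    using division_ofD(4)[OF div that] .
  have neg: "negligible (\<Union>{D \<in> snd ` p. \<not> 0 < measure lebesgue D})"
  proof (rule negligible_Union)
    fix D assume D: "D \<in> {D \<in> snd ` p. \<not> 0 < measure lebesgue D}"
    then have "measure lebesgue D = 0"
      using measure_nonneg[of lebesgue D] by (simp add: order_antisym)
    moreover have "D \<in> lmeasurable"
      using boxes D by force
    ultimately show "negligible D"
      by (simp add: negligible_iff_measure)
  qed (use fin in simp)
  have compD: "compact (\<Union>\<D>)"
  proof (intro compact_Union fin)
    fix D assume "D \<in> \<D>"
    then have "D \<in> snd ` p"
      by (simp add: \<D>_def)
    then obtain a b where "D = cbox a b"
      using boxes by meson
    then show "compact D"
      by simp
  qed
  have "A \<subseteq> \<Union>\<D> \<union> \<Union>{D \<in> snd ` p. \<not> 0 < measure lebesgue D}"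
  proof
    fix x assume "x \<in> A"
    then obtain D where "D \<in> snd ` p" "x \<in> D"
      using ab division_ofD(6)[OF div] by blast
    then show "x \<in> \<Union>\<D> \<union> \<Union>{D \<in> snd ` p. \<not> 0 < measure lebesgue D}"
      using \<open>x \<in> A\<close> unfolding \<D>_def by blast
  qed
  then have "measure lebesgue A \<le> measure lebesgue (\<Union>\<D> \<union> \<Union>{D \<in> snd ` p. \<not> 0 < measure lebesgue D})"
    using assms compD neg
    by (intro measure_mono_fmeasurable fmeasurable.Un)
      (auto simp: lmeasurable_compact negligible_iff_measure fmeasurableD)
  also have "\<dots> = measure lebesgue (\<Union>\<D>)"
    using compD neg by (intro measure_Un_null_set) (auto simp: lmeasurable_compact fmeasurableD negligible_iff_null_sets)
  finally have le: "measure lebesgue A \<le> measure lebesgue (\<Union>\<D>)" .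
  have "box_family \<D>"
    unfolding box_family_def
  proof (intro conjI ballI)
    show "\<D> \<noteq> {}"
      using le assms(2) by auto
    show "pairwise (\<lambda>D E. interior D \<inter> interior E = {}) \<D>"
      using division_ofD(5)[OF div] by (auto simp: \<D>_def pairwise_def)
  qed (use fin boxes in \<open>auto simp: \<D>_def\<close>)
  moreover have "\<Union>\<D> \<subseteq> A + cball 0 e"
  proof safe
    fix x D assume "x \<in> D" "D \<in> \<D>"
    then obtain y z where "y \<in> A" "y \<in> D" "D \<subseteq> ball z (e/2)"
      using p(2) by (fastforce simp: \<D>_def fine_def)
    then have "dist x y < e"
      using \<open>x \<in> D\<close> dist_triangle_half_l[of x z e y] by (auto simp: dist_commute subset_iff)
    then have "x - y \<in> cball 0 e"
      by (simp add: dist_norm norm_minus_commute)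
    then show "x \<in> A + cball 0 e"
      using set_plus_intro[OF \<open>y \<in> A\<close>, of "x - y" "cball 0 e"] by simp
  qed
  ultimately show ?thesis
    using that le by blast
qed

text \<open>If one set is null, the sum contains a translate of the other. Otherwise both are
  replaced by box families of at least the same volume inside their
  \<open>r/2\<close>-neighbourhoods, whose sum stays in the \<open>r\<close>-neighbourhood of
  \<open>A + B\<close>.\<close>

theorem brunn_minkowski:
  fixes A B :: "'a::euclidean_space set"
  assumes "compact A" "compact B" "A \<noteq> {}" "B \<noteq> {}"
  shows "vroot A + vroot B \<le> vroot (A + B)"
proof -
  have le_if_null: "vroot A + vroot B \<le> vroot (A + B)"
    if "compact A" "compact B" "A \<noteq> {}" "measure lebesgue A = 0" for A B :: "'a set"
  proof -
    obtain a where "a \<in> A"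
      using \<open>A \<noteq> {}\<close> by blast
    have "measure lebesgue ((+) a ` B) \<le> measure lebesgue (A + B)"
      using \<open>a \<in> A\<close> that
      by (intro measure_mono_fmeasurable)
        (auto intro!: fmeasurableD lmeasurable_compact compact_translation compact_set_plus)
    then show ?thesis
      using that by (simp add: measure_translation)
  qed
  consider "measure lebesgue A = 0" | "measure lebesgue B = 0"
    | "0 < measure lebesgue A" "0 < measure lebesgue B"
    using measure_nonneg[of lebesgue A] measure_nonneg[of lebesgue B] by linarith
  then show ?thesis
  proof cases
    case 1
    then show ?thesis
      using le_if_null assms by blast
  next
    case 2
    then show ?thesis
      using le_if_null[of B A] assms by (simp add: add.commute)
  next
    case 3
    \<comment> \<open>In terms of powers the approximation error is an additive \<open>e\<close> in
      the volume.\<close>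
    have "(vroot A + vroot B) ^ DIM('a) \<le> measure lebesgue (A + B) + e" if "0 < e" for e
    proof -
      have "A + B \<noteq> {}"
        using assms by (auto simp: set_plus_def)
      then obtain r where r: "0 < r" "measure lebesgue ((A + B) + cball 0 r) < measure lebesgue (A + B) + e"
        using compact_measure_outer[OF compact_set_plus[OF assms(1,2)]] \<open>0 < e\<close> by blast
      obtain \<D> where \<D>: "box_family \<D>" "measure lebesgue A \<le> measure lebesgue (\<Union>\<D>)" "\<Union>\<D> \<subseteq> A + cball 0 (r/2)"
        using box_family_outer[OF assms(1) 3(1), of "r/2"] r by auto
      obtain \<E> where \<E>: "box_family \<E>" "measure lebesgue B \<le> measure lebesgue (\<Union>\<E>)" "\<Union>\<E> \<subseteq> B + cball 0 (r/2)"
        using box_family_outer[OF assms(2) 3(2), of "r/2"] r by auto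
      have "cball 0 (r/2) + cball 0 (r/2) \<subseteq> cball (0::'a) r"
        by (auto simp: set_plus_def intro!: norm_triangle_le)
      have "\<Union>\<D> + \<Union>\<E> \<subseteq> (A + cball 0 (r/2)) + (B + cball 0 (r/2))"
        using \<D> \<E> by (intro set_plus_mono2)
      also have "\<dots> = (A + B) + (cball 0 (r/2) + cball 0 (r/2))"
        by (simp add: algebra_simps)
      also have "\<dots> \<subseteq> (A + B) + cball 0 r"
        by (intro set_plus_mono2 order_refl) fact
      finally have sub: "\<Union>\<D> + \<Union>\<E> \<subseteq> (A + B) + cball 0 r" .
      have "vroot A + vroot B \<le> vroot (\<Union>\<D>) + vroot (\<Union>\<E>)"
        using \<D> \<E> by (intro add_mono real_root_le_mono) auto
      also have "\<dots> \<le> vroot (\<Union>\<D> + \<Union>\<E>)"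
        by (rule brunn_minkowski_box_family) fact+
      also have "\<dots> \<le> vroot ((A + B) + cball 0 r)"
        using assms \<D> \<E>
        by (intro real_root_le_mono measure_mono_fmeasurable[OF sub] fmeasurableD lmeasurable_compact compact_set_plus)
          (auto simp: box_family_compact)
      finally have "(vroot A + vroot B) ^ DIM('a) \<le> vroot ((A + B) + cball 0 r) ^ DIM('a)"
        by (intro power_mono) auto
      then show ?thesis
        using r by (simp add: vroot_power)
    qed
    then have "(vroot A + vroot B) ^ DIM('a) \<le> vroot (A + B) ^ DIM('a)"
      by (simp add: vroot_power field_le_epsilon)
    then show ?thesis
      by (rule power_mono_iff[THEN iffD1, rotated -1]) auto
  qed
qed

section \<open>Equality: quantile functions\<close>

text \<open>The integral of the increment telescopes to the difference of the integrals of
  \<open>f\<close> over the two end intervals of length \<open>c\<close>, and monotonicity bounds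
  those.\<close>

lemma integral_shift_diff_mono_bounds:
  fixes f :: "real \<Rightarrow> real"
  assumes mono: "mono_on {a..b + c} f" and "a \<le> b" "0 \<le> c"
  shows "(\<lambda>x. f (x + c) - f x) integrable_on {a..b}"
    and "c * (f b - f (a + c)) \<le> integral {a..b} (\<lambda>x. f (x + c) - f x)"
    and "integral {a..b} (\<lambda>x. f (x + c) - f x) \<le> c * (f (b + c) - f a)"
proof -
  have int: "f integrable_on {u..v}" if "{u..v} \<subseteq> {a..b + c}" for u v
    using that mono by (intro integrable_on_mono_on) (auto intro: mono_on_subset)
  have "(f has_integral integral {a+c..b+c} f) {a+c..b+c}"
    using assms by (intro integrable_integral int) auto
  then have shift: "((\<lambda>x. f (x + c)) has_integral integral {a+c..b+c} f) {a..b}"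
    using has_integral_shift_real_ivl[of f _ "a+c" "b+c" c] by simp
  then show *: "(\<lambda>x. f (x + c) - f x) integrable_on {a..b}"
    using assms by (intro integrable_diff int) (auto simp: has_integral_integrable)
  have "integral {a..b} (\<lambda>x. f (x + c) - f x) = integral {a+c..b+c} f - integral {a..b} f"
    using assms shift by (subst integral_diff) (auto intro!: int simp: has_integral_integrable integral_unique)
  also have "\<dots> = integral {b..b+c} f - integral {a..a+c} f"
    using Henstock_Kurzweil_Integration.integral_combine[where a = a and c = "a+c" and b = "b+c" and f = f]
      Henstock_Kurzweil_Integration.integral_combine[where a = a and c = b and b = "b+c" and f = f] int assms by simp
  finally have eq: "integral {a..b} (\<lambda>x. f (x + c) - f x) = integral {b..b+c} f - integral {a..a+c} f" .
  have bounds: "c * f u \<le> integral {u..u+c} f" "integral {u..u+c} f \<le> c * f (u + c)"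
    if "a \<le> u" "u \<le> b" for u
  proof -
    have "f integrable_on {u..u+c}"
      using that by (intro int) auto
    then show "c * f u \<le> integral {u..u+c} f" "integral {u..u+c} f \<le> c * f (u + c)"
      using that \<open>0 \<le> c\<close> mono
        integral_le[of "\<lambda>_. f u" "{u..u+c}" f] integral_le[of f "{u..u+c}" "\<lambda>_. f (u + c)"]
      by (auto simp: mono_on_def)
  qed
  show "c * (f b - f (a + c)) \<le> integral {a..b} (\<lambda>x. f (x + c) - f x)"
    "integral {a..b} (\<lambda>x. f (x + c) - f x) \<le> c * (f (b + c) - f a)"
    using bounds[of a] bounds[of b] \<open>a \<le> b\<close> by (simp_all add: eq right_diff_distrib)
qed

text \<open>
  For \<open>p = q - \<beta> h\<close> and \<open>r = q + \<alpha> h + \<epsilon>\<close>, hypothesis \<open>key\<close> compares the increment of \<open>G\<close> to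
  the left of \<open>q\<close> with the increment of \<open>H\<close> to the right of \<open>q\<close>. Both sides telescope when
  integrated over \<open>q\<close>, so no regularity beyond monotonicity is needed.
\<close>

lemma quantile_increment_le:
  fixes G H :: "real \<Rightarrow> real"
  assumes \<alpha>\<beta>: "0 < \<alpha>" "0 < \<beta>" "\<alpha> + \<beta> = 1"
    and mono: "mono_on {0<..<P} G" "mono_on {0<..<P} H"
    and key: "\<And>p q r. \<lbrakk>0 < p; p < P; 0 < q; q < P; 0 < r; r < P; q < \<alpha> * p + \<beta> * r\<rbrakk>
      \<Longrightarrow> \<alpha> * G q + \<beta> * H q \<le> \<alpha> * G p + \<beta> * H r"
    and xy: "0 < x" "x < y1" "y1 < y2" "y2 < P"
  shows "G y1 - G x \<le> H y2 - H x"
proof -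
  define b where "b = (y1 + y2) / 2"
  \<comment> \<open>\<open>h < x\<close> keeps the left arguments positive; a quarter of
    \<open>y2 - y1\<close> leaves room around the midpoint \<open>b\<close> for the shifts
    \<open>k < h\<close> and \<open>c < 2 * h\<close>.\<close>
  define h where "h = min (x / 2) ((y2 - y1) / 4)"
  have b: "y1 < b" "b < y2" "b - y1 = (y2 - y1) / 2" "y2 - b = (y2 - y1) / 2"
    using xy by (auto simp: b_def field_simps)
  have h: "0 < h" "h < x" "h \<le> (y2 - y1) / 4"
    using xy min.cobounded2[of "x / 2" "(y2 - y1) / 4"] by (auto simp: h_def)
  define k where "k = \<beta> * h"
  have \<beta>h: "0 < k" "k < h"
    using \<alpha>\<beta> h by (auto simp: k_def)
  have \<alpha>h: "0 < \<alpha> * h" "\<alpha> * h < h"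
    using \<alpha>\<beta> h by auto
  have ineq: "G y1 - G x \<le> (1 + \<epsilon> / (\<alpha> * h)) * (H y2 - H x)" if \<epsilon>: "0 < \<epsilon>" "\<epsilon> < h" for \<epsilon>
  proof -
    define c where "c = \<alpha> * h + \<epsilon>"
    have c: "0 < c" "c < 2 * h"
      unfolding c_def using \<alpha>h \<epsilon> by linarith+
    have Gm: "mono_on {x - k..(b - k) + k} G"
      using b \<beta>h h xy by (intro mono_on_subset[OF mono(1)]) auto
    have Hm: "mono_on {x..b + c} H"
      using b c h xy by (intro mono_on_subset[OF mono(2)]) auto
    have "x - k \<le> b - k" "x \<le> b"
      using b xy by auto
    note bG = integral_shift_diff_mono_bounds[OF Gm this(1)] and bH = integral_shift_diff_mono_bounds[OF Hm this(2)]
    \<comment> \<open>Moving the window by \<open>k\<close> turns increments to the left into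
      increments to the right, to which the bounds \<open>bG\<close> apply.\<close>
    have shift: "((\<lambda>q. G q - G (q - k)) has_integral
        integral {x - k..b - k} (\<lambda>q. G (q + k) - G q)) {x..b}"
      using has_integral_shift_real_ivl[OF integrable_integral[OF bG(1)], of "- k"] \<beta>h by simp
    have "\<alpha> * (k * (G (b - k) - G x)) \<le> \<alpha> * integral {x..b} (\<lambda>q. G q - G (q - k))"
      using bG(2) \<beta>h \<alpha>\<beta> integral_unique[OF shift] by simp
    also have "\<dots> = integral {x..b} (\<lambda>q. \<alpha> * (G q - G (q - k)))"
      by simp
    also have "\<dots> \<le> integral {x..b} (\<lambda>q. \<beta> * (H (q + c) - H q))"
    proof (rule integral_le)
      show "(\<lambda>q. \<alpha> * (G q - G (q - k))) integrable_on {x..b}"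
        using shift by (intro integrable_on_mult_right) (auto simp: has_integral_integrable)
      show "(\<lambda>q. \<beta> * (H (q + c) - H q)) integrable_on {x..b}"
        using bH(1) c by (intro integrable_on_mult_right) auto
      fix q assume q: "q \<in> {x..b}"
      have "\<alpha> * G q + \<beta> * H q \<le> \<alpha> * G (q - k) + \<beta> * H (q + c)"
      proof (rule key)
        \<comment> \<open>The terms in \<open>h\<close> cancel; the surplus
          \<open>\<beta> * \<epsilon>\<close> provides the strict inequality that \<open>key\<close>
          requires.\<close>
        have "\<alpha> * (q - k) + \<beta> * (q + c) = (\<alpha> + \<beta>) * q + \<beta> * \<epsilon>"
          by (simp add: c_def k_def algebra_simps)
        then show "q < \<alpha> * (q - k) + \<beta> * (q + c)"
          using \<alpha>\<beta> \<epsilon> by simp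
      qed (use q b c h \<beta>h xy in auto)
      then show "\<alpha> * (G q - G (q - k)) \<le> \<beta> * (H (q + c) - H q)"
        by (simp add: algebra_simps)
    qed
    also have "\<dots> = \<beta> * integral {x..b} (\<lambda>q. H (q + c) - H q)"
      by simp
    also have "\<dots> \<le> \<beta> * (c * (H (b + c) - H x))"
      using bH(3) c \<alpha>\<beta> by (intro mult_left_mono) auto
    finally have "\<beta> * (\<alpha> * h * (G (b - k) - G x)) \<le> \<beta> * (c * (H (b + c) - H x))"
      by (simp add: k_def mult_ac)
    then have "\<alpha> * h * (G (b - k) - G x) \<le> c * (H (b + c) - H x)"
      using \<alpha>\<beta> by simp
    moreover have "G y1 \<le> G (b - k)" "H (b + c) \<le> H y2"
      using b c h \<beta>h xy by (auto intro!: mono_onD[OF mono(1)] mono_onD[OF mono(2)])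
    ultimately have "\<alpha> * h * (G y1 - G x) \<le> c * (H y2 - H x)"
      using \<alpha>h c by (smt (verit) mult_left_mono)
    then have "G y1 - G x \<le> c * (H y2 - H x) / (\<alpha> * h)"
      using \<alpha>h by (simp add: pos_le_divide_eq mult.commute)
    also have "\<dots> = (1 + \<epsilon> / (\<alpha> * h)) * (H y2 - H x)"
    proof -
      have "c / (\<alpha> * h) = 1 + \<epsilon> / (\<alpha> * h)"
        using \<alpha>h(1) unfolding c_def add_divide_distrib by (metis div_self less_irrefl)
      then show ?thesis
        by (metis times_divide_eq_left)
    qed
    finally show ?thesis .
  qed
  \<comment> \<open>The surplus enters only through the factor
    \<open>1 + \<epsilon> / (\<alpha> * h)\<close>, which tends to 1.\<close>
  have "((\<lambda>\<epsilon>. (1 + \<epsilon> / (\<alpha> * h)) * (H y2 - H x)) \<longlongrightarrow> (1 + 0 / (\<alpha> * h)) * (H y2 - H x)) (at_right 0)"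
    using \<alpha>h by (intro tendsto_intros) auto
  moreover have "eventually (\<lambda>\<epsilon>. G y1 - G x \<le> (1 + \<epsilon> / (\<alpha> * h)) * (H y2 - H x)) (at_right 0)"
    using eventually_at_right_less[of 0] order_tendstoD(2)[OF tendsto_ident_at \<open>0 < h\<close>]
    by eventually_elim (rule ineq)
  ultimately show ?thesis
    using tendsto_lowerbound[of _ _ "at_right (0::real)" "G y1 - G x"] by fastforce
qed

text \<open>In \<open>quantile_increment_le\<close> the left end tends to 0, where \<open>G\<close>
  and \<open>H\<close> approach their infima; \<open>c\<close> is the difference of these. Quantile
  functions may jump, hence the comparison at two arguments \<open>y < z\<close>.\<close>

lemma quantiles_differ_by_constant:
  fixes G H :: "real \<Rightarrow> real"
  assumes "0 < P" and \<alpha>\<beta>: "0 < \<alpha>" "0 < \<beta>" "\<alpha> + \<beta> = 1"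
    and mono: "mono_on {0<..<P} G" "mono_on {0<..<P} H"
    and bdd: "\<And>p. \<lbrakk>0 < p; p < P\<rbrakk> \<Longrightarrow> L \<le> G p" "\<And>p. \<lbrakk>0 < p; p < P\<rbrakk> \<Longrightarrow> L \<le> H p"
    and key: "\<And>p q r. \<lbrakk>0 < p; p < P; 0 < q; q < P; 0 < r; r < P; q < \<alpha> * p + \<beta> * r\<rbrakk>
      \<Longrightarrow> \<alpha> * G q + \<beta> * H q \<le> \<alpha> * G p + \<beta> * H r"
  obtains c where "\<And>y z. \<lbrakk>0 < y; y < z; z < P\<rbrakk> \<Longrightarrow> G y + c \<le> H z \<and> H y \<le> G z + c"
proof -
  define g where "g = Inf (G ` {0<..<P})"
  define k where "k = Inf (H ` {0<..<P})"
  have ne: "{0<..<P} \<noteq> {}"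
    using \<open>0 < P\<close> by auto
  have bb: "bdd_below (G ` {0<..<P})" "bdd_below (H ` {0<..<P})"
    using bdd by (auto intro!: bdd_belowI2)
  have near: "\<exists>x. 0 < x \<and> x < y \<and> G x < g + e \<and> H x < k + e" if "0 < e" "0 < y" "y < P" for e y
  proof -
    obtain p where p: "0 < p" "p < P" "G p < g + e"
      using cInf_lessD[of "G ` {0<..<P}" "g + e"] ne \<open>0 < e\<close> by (auto simp: g_def)
    obtain r where r: "0 < r" "r < P" "H r < k + e"
      using cInf_lessD[of "H ` {0<..<P}" "k + e"] ne \<open>0 < e\<close> by (auto simp: k_def)
    \<comment> \<open>By monotonicity any point below both \<open>p\<close> and \<open>r\<close> is
      close to both infima.\<close>
    define x where "x = min (min p r) (y / 2)"
    have "0 < x" "x < y" "x \<le> p" "x \<le> r" "x < P"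
      using p r that by (auto simp: x_def)
    moreover from this have "G x \<le> G p" "H x \<le> H r"
      using p r by (auto intro!: mono_onD[OF mono(1)] mono_onD[OF mono(2)])
    ultimately show ?thesis
      using p r by (intro exI[of _ x]) auto
  qed
  have lower: "g \<le> G x" "k \<le> H x" if "0 < x" "x < P" for x
    using that bb unfolding g_def k_def by (auto intro!: cInf_lower)
  \<comment> \<open>Exchanging \<open>G\<close>, \<open>\<alpha>\<close> with \<open>H\<close>,
    \<open>\<beta>\<close> gives the reverse comparison.\<close>
  have key': "\<beta> * H q + \<alpha> * G q \<le> \<beta> * H p + \<alpha> * G r"
    if "0 < p" "p < P" "0 < q" "q < P" "0 < r" "r < P" "q < \<beta> * p + \<alpha> * r" for p q r
    using key[of r q p] that by (simp add: add.commute)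
  show thesis
  proof (rule that[of "k - g"], intro conjI)
    fix y z assume yz: "0 < y" "y < z" "z < P"
    show "G y + (k - g) \<le> H z"
    proof (rule field_le_epsilon)
      fix e :: real assume "0 < e"
      then obtain x where x: "0 < x" "x < y" "G x < g + e"
        using near[of e y] yz by auto
      then have "G y - G x \<le> H z - H x"
        using quantile_increment_le[OF \<alpha>\<beta> mono key] yz by blast
      moreover have "k \<le> H x"
        using lower x yz by auto
      ultimately show "G y + (k - g) \<le> H z + e"
        using x by linarith
    qed
    show "H y \<le> G z + (k - g)"
    proof (rule field_le_epsilon)
      fix e :: real assume "0 < e"
      then obtain x where x: "0 < x" "x < y" "H x < k + e"
        using near[of e y] yz by auto
      have "\<beta> + \<alpha> = 1"
        using \<alpha>\<beta> by simp
      then have "H y - H x \<le> G z - G x"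
        using quantile_increment_le[OF \<alpha>\<beta>(2,1) _ mono(2,1) key'] yz x by blast
      moreover have "g \<le> G x"
        using lower x yz by auto
      ultimately show "H y \<le> G z + (k - g) + e"
        using x by linarith
    qed
  qed
qed

section \<open>From quantile functions to halfspace measures\<close>

lemma vroot_scaleR: "vroot ((*\<^sub>R) c ` (S :: 'a::euclidean_space set)) = \<bar>c\<bar> * vroot S"
proof -
  have "measure lebesgue ((*\<^sub>R) c ` S) = \<bar>c\<bar> ^ DIM('a) * measure lebesgue S"
    using measure_lebesgue_affine[of c 0 S] by simp
  then show ?thesis
    by (simp add: real_root_mult real_root_power_cancel)
qed

lemma compact_scaleR_image: "compact S \<Longrightarrow> compact ((*\<^sub>R) c ` (S :: 'a::real_normed_vector set))"
  using compact_scaling by blast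

lemma brunn_minkowski_scaled:
  fixes A B :: "'a::euclidean_space set"
  assumes "compact A" "compact B" "A \<noteq> {}" "B \<noteq> {}" "0 \<le> \<alpha>" "0 \<le> \<beta>"
  shows "(\<alpha> * vroot A + \<beta> * vroot B) ^ DIM('a) \<le> measure lebesgue ((*\<^sub>R) \<alpha> ` A + (*\<^sub>R) \<beta> ` B)"
proof -
  have "\<alpha> * vroot A + \<beta> * vroot B = vroot ((*\<^sub>R) \<alpha> ` A) + vroot ((*\<^sub>R) \<beta> ` B)"
    using assms by (simp add: vroot_scaleR)
  also have "\<dots> \<le> vroot ((*\<^sub>R) \<alpha> ` A + (*\<^sub>R) \<beta> ` B)"
    using assms by (intro brunn_minkowski compact_scaleR_image) auto
  finally have "(\<alpha> * vroot A + \<beta> * vroot B) ^ DIM('a) \<le> vroot ((*\<^sub>R) \<alpha> ` A + (*\<^sub>R) \<beta> ` B) ^ DIM('a)"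
    using assms by (intro power_mono) auto
  then show ?thesis
    by (simp add: vroot_power)
qed

text \<open>The parameter is the root of the volume cut off, the scale in which the Brunn-Minkowski
  inequality is linear. The lower bound on \<open>G\<close> later guarantees a finite
  infimum.\<close>

lemma quantile_function_ex:
  fixes A :: "'a::euclidean_space set"
  assumes "compact A" "u \<noteq> 0" "0 \<le> R" "\<And>x. x \<in> A \<Longrightarrow> \<bar>u \<bullet> x\<bar> \<le> R"
  obtains G where "\<And>p. \<lbrakk>0 \<le> p; p \<le> vroot A\<rbrakk> \<Longrightarrow>
      -R - 1 \<le> G p \<and> measure lebesgue (A \<inter> {x. u \<bullet> x \<le> G p}) = p ^ DIM('a)"
proof -
  have "\<exists>s. -R - 1 \<le> s \<and> measure lebesgue (A \<inter> {x. u \<bullet> x \<le> s}) = p ^ DIM('a)"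
    if "0 \<le> p" "p \<le> vroot A" for p
  proof -
    have "p ^ DIM('a) \<le> measure lebesgue A"
      using power_mono[OF that(2,1), of "DIM('a)"] by (simp add: vroot_power)
    then show ?thesis
      using halfspace_quantile_ex[OF assms(1,2) _ _ assms(3,4), of "p ^ DIM('a)"] that
      by (metis zero_le_power)
  qed
  then show ?thesis
    using that by metis
qed

text \<open>Equality makes cuts at unequal ratios no better than cuts at equal ones. This is the
  hypothesis of \<open>quantiles_differ_by_constant\<close>, whose constant becomes the shift
  between the distribution functions \<open>FA\<close> and \<open>FB\<close>.\<close>

lemma brunn_minkowski_eq_halfspace_measures:
  fixes A B :: "'a::euclidean_space set"
  assumes comp: "compact A" "compact B" and "u \<noteq> 0"
    and \<alpha>\<beta>: "0 < \<alpha>" "0 < \<beta>" "\<alpha> + \<beta> = 1"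
    and vol: "0 < measure lebesgue A" "measure lebesgue B = measure lebesgue A"
      "measure lebesgue ((*\<^sub>R) \<alpha> ` A + (*\<^sub>R) \<beta> ` B) = measure lebesgue A"
  obtains c where "\<And>s. measure lebesgue (A \<inter> {x. u \<bullet> x \<le> s}) = measure lebesgue (B \<inter> {x. u \<bullet> x \<le> s + c})"
proof -
  let ?\<mu> = "measure (lebesgue :: 'a measure)" and ?n = "DIM('a)"
  define P where "P = vroot A"
  have P: "0 < P" "P ^ ?n = ?\<mu> A" "vroot B = P"
    using vol by (auto simp: P_def vroot_power)
  define FA where "FA s = ?\<mu> (A \<inter> {x. u \<bullet> x \<le> s})" for s
  define FB where "FB s = ?\<mu> (B \<inter> {x. u \<bullet> x \<le> s})" for s
  have FA_mono: "FA s \<le> FA t" and FB_mono: "FB s \<le> FB t" if "s \<le> t" for s t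
    using that comp unfolding FA_def FB_def
    by (intro measure_mono_fmeasurable fmeasurableD lmeasurable_compact compact_Int_halfspace; force)+
  have FA_le: "0 \<le> FA s" "FA s \<le> P ^ ?n" and FB_le: "0 \<le> FB s" "FB s \<le> P ^ ?n" for s
  proof -
    show "0 \<le> FA s" "0 \<le> FB s"
      by (simp_all add: FA_def FB_def)
    have "FA s \<le> ?\<mu> A" "FB s \<le> ?\<mu> B"
      using comp unfolding FA_def FB_def
      by (intro measure_mono_fmeasurable fmeasurableD lmeasurable_compact compact_Int_halfspace; blast)+
    then show "FA s \<le> P ^ ?n" "FB s \<le> P ^ ?n"
      by (simp_all add: P(2) vol(2))
  qed
  have "bounded (A \<union> B)"
    using comp by (simp add: compact_imp_bounded)
  then obtain r where r: "0 < r" "\<And>x. x \<in> A \<union> B \<Longrightarrow> norm x \<le> r"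
    by (auto simp: bounded_pos)
  define R where "R = norm u * r"
  have R: "0 \<le> R" "\<bar>u \<bullet> x\<bar> \<le> R" if "x \<in> A \<union> B" for x
    using r that Cauchy_Schwarz_ineq2[of u x] mult_left_mono[of "norm x" r "norm u"]
    by (auto simp: R_def intro: order_trans)
  have "0 \<le> R"
    using r by (simp add: R_def)
  obtain G where G: "\<And>p. \<lbrakk>0 \<le> p; p \<le> P\<rbrakk> \<Longrightarrow> -R - 1 \<le> G p \<and> FA (G p) = p ^ ?n"
    using quantile_function_ex[OF comp(1) \<open>u \<noteq> 0\<close> \<open>0 \<le> R\<close>] R unfolding FA_def P_def by (metis UnCI)
  obtain H where H: "\<And>p. \<lbrakk>0 \<le> p; p \<le> P\<rbrakk> \<Longrightarrow> -R - 1 \<le> H p \<and> FB (H p) = p ^ ?n"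
    using quantile_function_ex[OF comp(2) \<open>u \<noteq> 0\<close> \<open>0 \<le> R\<close>] R unfolding FB_def P(3) by (metis UnCI)
  have pow_less: "p ^ ?n < q ^ ?n" if "p < q" "0 \<le> p" for p q :: real
    using that by (intro power_strict_mono) auto
  \<comment> \<open>A quantile is an arbitrary level with the right volume, so it is used only
    through strict implications of this kind.\<close>
  have G_less: "s < G q" if "FA s < q ^ ?n" "0 \<le> q" "q \<le> P" for s q
    using that G[of q] FA_mono[of "G q" s] by - (rule ccontr, simp add: not_less)
  have less_G: "G q < s" if "q ^ ?n < FA s" "0 \<le> q" "q \<le> P" for s q
    using that G[of q] FA_mono[of s "G q"] by - (rule ccontr, simp add: not_less)
  have H_less: "s < H q" if "FB s < q ^ ?n" "0 \<le> q" "q \<le> P" for s q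
    using that H[of q] FB_mono[of "H q" s] by - (rule ccontr, simp add: not_less)
  have less_H: "H q < s" if "q ^ ?n < FB s" "0 \<le> q" "q \<le> P" for s q
    using that H[of q] FB_mono[of s "H q"] by - (rule ccontr, simp add: not_less)
  have mono: "mono_on {0<..<P} G" "mono_on {0<..<P} H"
  proof -
    have "G p \<le> G q" "H p \<le> H q" if "p \<in> {0<..<P}" "q \<in> {0<..<P}" "p \<le> q" for p q
      using that G_less[of "G p" q] H_less[of "H p" q] G[of p] H[of p] pow_less[of p q]
      by (cases "p = q"; force)+
    then show "mono_on {0<..<P} G" "mono_on {0<..<P} H"
      by (auto simp: mono_on_def)
  qed
  \<comment> \<open>Otherwise the sum of the lower parts, up to \<open>G p\<close> and
    \<open>H r\<close>, and that of the upper parts, from \<open>G q\<close> and \<open>H q\<close>,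
    would be separated by a hyperplane. Their volumes would total at least
    \<open>(\<alpha> * p + \<beta> * r) ^ ?n + P ^ ?n - q ^ ?n\<close>, which exceeds the volume
    \<open>P ^ ?n\<close> of the whole.\<close>
  have key: "\<alpha> * G q + \<beta> * H q \<le> \<alpha> * G p + \<beta> * H r"
    if *: "0 < p" "p < P" "0 < q" "q < P" "0 < r" "r < P" "q < \<alpha> * p + \<beta> * r" for p q r
  proof (rule ccontr)
    assume "\<not> ?thesis"
    then have less: "\<alpha> * G p + \<beta> * H r \<le> \<alpha> * G q + \<beta> * H q"
      by simp
    define A1 A2 B1 B2 where "A1 = A \<inter> {x. u \<bullet> x \<le> G p}" and "A2 = A \<inter> {x. G q \<le> u \<bullet> x}"
      and "B1 = B \<inter> {x. u \<bullet> x \<le> H r}" and "B2 = B \<inter> {x. H q \<le> u \<bullet> x}"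
    have c12: "compact A1" "compact A2" "compact B1" "compact B2"
      using comp by (auto simp: A1_def A2_def B1_def B2_def intro: compact_Int_halfspace)
    have m1: "?\<mu> A1 = p ^ ?n" "?\<mu> B1 = r ^ ?n"
      using * G[of p] H[of r] by (auto simp: A1_def B1_def FA_def FB_def)
    have "FA (G q) = q ^ ?n" "FB (H q) = q ^ ?n"
      using * G[of q] H[of q] by auto
    then have m2: "?\<mu> A2 = P ^ ?n - q ^ ?n" "?\<mu> B2 = P ^ ?n - q ^ ?n"
      using measure_halfspace_split[OF comp(1) \<open>u \<noteq> 0\<close>, of "G q"]
        measure_halfspace_split[OF comp(2) \<open>u \<noteq> 0\<close>, of "H q"]
      unfolding A2_def B2_def FA_def FB_def P(2) vol(2) by linarith+
    have pos: "0 < p ^ ?n" "0 < r ^ ?n" "0 < P ^ ?n - q ^ ?n"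
      using * pow_less[of q P] by auto
    then have ne: "A1 \<noteq> {}" "A2 \<noteq> {}" "B1 \<noteq> {}" "B2 \<noteq> {}"
      using m1 m2 by (metis measure_empty less_irrefl)+
    have root: "root ?n (x ^ ?n) = x" if "0 < x" for x :: real
      using that by (simp add: real_root_power_cancel)
    have "(\<alpha> * p + \<beta> * r) ^ ?n \<le> ?\<mu> ((*\<^sub>R) \<alpha> ` A1 + (*\<^sub>R) \<beta> ` B1)"
      using brunn_minkowski_scaled[OF c12(1,3) ne(1,3), of \<alpha> \<beta>] \<alpha>\<beta> * by (simp add: m1 root)
    moreover have "P ^ ?n - q ^ ?n \<le> ?\<mu> ((*\<^sub>R) \<alpha> ` A2 + (*\<^sub>R) \<beta> ` B2)"
      using brunn_minkowski_scaled[OF c12(2,4) ne(2,4), of \<alpha> \<beta>] \<alpha>\<beta> pos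
      by (simp add: m2 distrib_right[symmetric] real_root_pow_pos2)
    moreover have "?\<mu> ((*\<^sub>R) \<alpha> ` A1 + (*\<^sub>R) \<beta> ` B1) + ?\<mu> ((*\<^sub>R) \<alpha> ` A2 + (*\<^sub>R) \<beta> ` B2)
        \<le> ?\<mu> ((*\<^sub>R) \<alpha> ` A + (*\<^sub>R) \<beta> ` B)"
      using \<open>u \<noteq> 0\<close> comp c12 \<alpha>\<beta> less
      by (intro measure_halfspace_cut_le[where u = u and s = "\<alpha> * G p" and t = "\<beta> * H r"
            and s' = "\<alpha> * G q" and t' = "\<beta> * H q"] compact_scaleR_image)
        (auto simp: A1_def A2_def B1_def B2_def)
    moreover have "q ^ ?n < (\<alpha> * p + \<beta> * r) ^ ?n"
      using * by (intro pow_less) auto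
    ultimately show False
      using vol(3) P(2) by linarith
  qed
  obtain c where c: "\<And>y z. \<lbrakk>0 < y; y < z; z < P\<rbrakk> \<Longrightarrow> G y + c \<le> H z \<and> H y \<le> G z + c"
    by (rule quantiles_differ_by_constant[OF P(1) \<alpha>\<beta> mono _ _ key, of "-R - 1"]) (use G H in auto)
  have "FA s = FB (s + c)" for s
  proof (rule ccontr)
    assume ne: "FA s \<noteq> FB (s + c)"
    \<comment> \<open>Two intermediate values are needed because \<open>c\<close> compares quantiles
      at strictly ordered arguments only.\<close>
    have between: "\<exists>y z. 0 < y \<and> y < z \<and> z < P \<and> a < y ^ ?n \<and> z ^ ?n < b"
      if "0 \<le> a" "a < b" "b \<le> P ^ ?n" for a b
    proof -
      have "root ?n a < root ?n b"
        using that by simp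
      then obtain y where y: "root ?n a < y" "y < root ?n b"
        using dense by blast
      then obtain z where z: "y < z" "z < root ?n b"
        using dense by blast
      have "root ?n b \<le> root ?n (P ^ ?n)"
        using that by (intro real_root_le_mono) auto
      then have "root ?n b \<le> P"
        using P(1) by (simp add: real_root_power_cancel)
      moreover have "0 \<le> root ?n a"
        using that by simp
      moreover have "a < y ^ ?n"
        using pow_less[OF y(1)] that by (simp add: real_root_pow_pos2)
      moreover have "z ^ ?n < b"
        using pow_less[OF z(2)] that y z calculation by (simp add: real_root_pow_pos2)
      moreover have "0 < y" "z < P"
        using calculation(1,2) y z by linarith+
      ultimately show ?thesis
        using z by blast
    qed
    consider "FA s < FB (s + c)" | "FB (s + c) < FA s"
      using ne by linarith
    then show False
    proof cases
      case 1
      then obtain y z where yz: "0 < y" "y < z" "z < P" "FA s < y ^ ?n" "z ^ ?n < FB (s + c)"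
        using between FA_le FB_le by meson
      then have "s < G y" "H z < s + c"
        by (auto intro!: G_less less_H)
      then show False
        using c[of y z] yz by auto
    next
      case 2
      then obtain y z where yz: "0 < y" "y < z" "z < P" "FB (s + c) < y ^ ?n" "z ^ ?n < FA s"
        using between FA_le FB_le by meson
      then have "s + c < H y" "G z < s"
        by (auto intro!: H_less less_G)
      then show False
        using c[of y z] yz by auto
    qed
  qed
  then show ?thesis
    using that unfolding FA_def FB_def by blast
qed

section \<open>Equality: halfspace measures determine the set\<close>

lemma integrable_lebesgue_on_compact:
  fixes f :: "'a::euclidean_space \<Rightarrow> 'b::{banach, second_countable_topology}"
  assumes "compact A" "continuous_on A f"
  shows "integrable (lebesgue_on A) f"
proof -
  have "integrable lborel (\<lambda>x. indicator A x *\<^sub>R f x)"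
    using borel_integrable_compact assms by blast
  then have "integrable lebesgue (\<lambda>x. indicator A x *\<^sub>R f x)"
    by (metis borel_measurable_integrable integrable_completion)
  then show ?thesis
    using assms by (simp add: integrable_restrict_space fmeasurableD lmeasurable_compact)
qed

lemma measurable_inner_lebesgue_on:
  fixes u :: "'a::euclidean_space"
  shows "(\<lambda>x. u \<bullet> x - c) \<in> borel_measurable (lebesgue_on A)"
proof -
  have "(\<lambda>x. u \<bullet> x - c) \<in> borel_measurable borel"
    by (intro borel_measurable_continuous_onI continuous_intros)
  then have "(\<lambda>x. u \<bullet> x - c) \<in> borel_measurable lebesgue"
    by (simp add: measurable_completion)
  then show ?thesis
    by (rule measurable_restrict_space1)
qed

text \<open>The images of the two restricted measures under \<open>u \<bullet> x\<close> and
  \<open>u \<bullet> x - c\<close> agree on all open upper rays, hence as Borel measures on the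
  line.\<close>

lemma integral_eq_if_halfspace_measures_eq:
  fixes A B :: "'a::euclidean_space set" and g :: "real \<Rightarrow> real"
  assumes comp: "compact A" "compact B" and "u \<noteq> 0" and vol: "measure lebesgue A = measure lebesgue B"
    and eq: "\<And>s. measure lebesgue (A \<inter> {x. u \<bullet> x \<le> s}) = measure lebesgue (B \<inter> {x. u \<bullet> x \<le> s + c})"
    and g: "g \<in> borel_measurable borel"
  shows "(\<integral>x. g (u \<bullet> x) \<partial>lebesgue_on A) = (\<integral>x. g (u \<bullet> x - c) \<partial>lebesgue_on B)"
proof -
  define D where "D S d = distr (lebesgue_on S) borel (\<lambda>x. u \<bullet> x - d)" for S d
  have emD: "emeasure (D S d) {t<..} = ennreal (measure lebesgue S - measure lebesgue (S \<inter> {x. u \<bullet> x \<le> t + d}))"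
    if "compact S" for S d t
  proof -
    have meas: "S \<in> lmeasurable" "S \<inter> {x. u \<bullet> x \<le> t + d} \<in> lmeasurable"
      using that compact_Int_halfspace(1)[OF that] by (auto simp: lmeasurable_compact)
    have "emeasure (D S d) {t<..} = emeasure (lebesgue_on S) ((\<lambda>x. u \<bullet> x - d) -` {t<..} \<inter> S)"
      unfolding D_def by (subst emeasure_distr) (auto simp: measurable_inner_lebesgue_on space_restrict_space)
    also have "(\<lambda>x. u \<bullet> x - d) -` {t<..} \<inter> S = S - (S \<inter> {x. u \<bullet> x \<le> t + d})"
      by auto
    also have "emeasure (lebesgue_on S) \<dots> = emeasure lebesgue \<dots>"
      using meas by (intro emeasure_restrict_space) (auto simp: fmeasurableD)
    also have "\<dots> = measure lebesgue (S - (S \<inter> {x. u \<bullet> x \<le> t + d}))"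
      using meas by (intro emeasure_eq_measure2) (auto intro: fmeasurable.Diff)
    also have "measure lebesgue (S - (S \<inter> {x. u \<bullet> x \<le> t + d})) = measure lebesgue S - measure lebesgue (S \<inter> {x. u \<bullet> x \<le> t + d})"
      using meas by (intro measurable_measure_Diff) (auto simp: fmeasurableD)
    finally show ?thesis .
  qed
  have "D A 0 = D B c"
  proof (rule measure_eqI_lessThan)
    show "sets (D A 0) = sets borel" "sets (D B c) = sets borel"
      by (simp_all add: D_def)
    show "emeasure (D A 0) {x<..} < \<infinity>" for x
      using comp by (simp add: emD)
    show "emeasure (D A 0) {x<..} = emeasure (D B c) {x<..}" for x
      using comp by (simp add: emD vol eq)
  qed
  moreover have "(\<integral>x. g (u \<bullet> x - d) \<partial>lebesgue_on S) = integral\<^sup>L (D S d) g" for S d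
    unfolding D_def using g measurable_inner_lebesgue_on by (subst integral_distr) auto
  from this[where d = 0 and S = A] this[where d = c and S = B] show ?thesis
    using calculation by simp
qed

text \<open>
  The span of the exponentials is closed under multiplication, so that the
  Stone-Weierstrass theorem applies to it directly.
\<close>

inductive_set exp_sums :: "('a::real_inner \<Rightarrow> real) set" where
  single: "(\<lambda>x. a * exp (u \<bullet> x)) \<in> exp_sums"
| add: "f \<in> exp_sums \<Longrightarrow> g \<in> exp_sums \<Longrightarrow> (\<lambda>x. f x + g x) \<in> exp_sums"

lemma exp_sums_mult:
  assumes "f \<in> exp_sums" "g \<in> exp_sums"
  shows "(\<lambda>x. f x * g x) \<in> exp_sums"
  using assms(1)
proof induction
  case (single a u)
  show ?case
    using assms(2)
  proof induction
    case (single b v)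
    have "(\<lambda>x. a * exp (u \<bullet> x) * (b * exp (v \<bullet> x))) = (\<lambda>x. (a * b) * exp ((u + v) \<bullet> x))"
      by (simp add: inner_add_left exp_add fun_eq_iff)
    then show ?case
      by (metis exp_sums.single)
  next
    case (add f g)
    then show ?case
      using exp_sums.add[OF add.IH] by (simp add: distrib_left)
  qed
next
  case (add f g)
  then show ?case
    using exp_sums.add[OF add.IH] by (simp add: distrib_right)
qed

lemma continuous_on_exp_sums: "f \<in> exp_sums \<Longrightarrow> continuous_on S f"
  by (induction rule: exp_sums.induct) (auto intro!: continuous_intros)

text \<open>Equality of the integrals passes from exponentials to their sums and then, by uniform
  approximation on \<open>A \<union> B\<close>, to the distance from \<open>A\<close>, whose
  integral over \<open>A\<close> is zero.\<close>

lemma negligible_diff_if_exp_integrals_eq: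
  fixes A B :: "'a::euclidean_space set"
  assumes comp: "compact A" "compact B" and "A \<noteq> {}"
    and eq: "\<And>u. (\<integral>x. exp (u \<bullet> x) \<partial>lebesgue_on A) = (\<integral>x. exp (u \<bullet> x) \<partial>lebesgue_on B)"
  shows "negligible (B - A)"
proof -
  let ?IA = "integral\<^sup>L (lebesgue_on A)" and ?IB = "integral\<^sup>L (lebesgue_on B)"
  interpret function_ring_on "exp_sums :: ('a \<Rightarrow> real) set" "A \<union> B"
  proof
    show "(\<lambda>_. c) \<in> exp_sums" for c :: real
      using exp_sums.single[of c 0] by simp
    show "\<exists>f\<in>exp_sums. f x \<noteq> f y" if "x \<noteq> y" for x y :: 'a
    proof
      show "(\<lambda>z. 1 * exp ((x - y) \<bullet> z)) \<in> exp_sums"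
        by (rule exp_sums.single)
      have "0 < (x - y) \<bullet> (x - y)"
        using that by simp
      then show "1 * exp ((x - y) \<bullet> x) \<noteq> 1 * exp ((x - y) \<bullet> y)"
        by (simp add: inner_diff_right)
    qed
  qed (use comp in \<open>auto intro: exp_sums_mult exp_sums.add continuous_on_exp_sums\<close>)
  have int: "integrable (lebesgue_on A) f" "integrable (lebesgue_on B) f"
    if "continuous_on (A \<union> B) f" for f :: "'a \<Rightarrow> real"
    using that comp by (auto intro!: integrable_lebesgue_on_compact intro: continuous_on_subset)
  have exp_sums_eq: "?IA f = ?IB f" if "f \<in> exp_sums" for f
    using that
  proof induction
    case (single a u)
    then show ?case
      using eq by simp
  next
    case (add f g)
    then show ?case
      using int[OF continuous_on_exp_sums[OF add.hyps(1)]] int[OF continuous_on_exp_sums[OF add.hyps(2)]]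
      by (simp add: Bochner_Integration.integral_add)
  qed
  define m where "m = measure lebesgue A + measure lebesgue B"
  \<comment> \<open>\<open>f\<close> vanishes on \<open>A\<close> only, so \<open>B - A\<close> is null once the integral of \<open>f\<close> over \<open>B\<close> is zero.\<close>
  define f where "f = (\<lambda>x. infdist x A)"
  have cont: "continuous_on (A \<union> B) f"
    unfolding f_def by (intro continuous_intros)
  have close: "\<bar>(\<integral>x. f x \<partial>lebesgue_on S) - (\<integral>x. g x \<partial>lebesgue_on S)\<bar> \<le> e * measure lebesgue S"
    if "compact S" "S \<subseteq> A \<union> B" "g \<in> exp_sums" "\<And>x. x \<in> A \<union> B \<Longrightarrow> \<bar>f x - g x\<bar> < e" for S g e
  proof -
    have i: "integrable (lebesgue_on S) f" "integrable (lebesgue_on S) g"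
      using that continuous_on_subset[OF cont]
      by (auto intro!: integrable_lebesgue_on_compact intro: continuous_on_exp_sums)
    have S: "S \<in> lmeasurable"
      using that lmeasurable_compact by blast
    have "\<bar>(\<integral>x. f x \<partial>lebesgue_on S) - (\<integral>x. g x \<partial>lebesgue_on S)\<bar> = \<bar>\<integral>x. f x - g x \<partial>lebesgue_on S\<bar>"
      using i by simp
    also have "\<dots> \<le> (\<integral>x. \<bar>f x - g x\<bar> \<partial>lebesgue_on S)"
      by (rule integral_abs_bound)
    also have "\<dots> \<le> (\<integral>x. e \<partial>lebesgue_on S)"
    proof (rule integral_mono)
      show "integrable (lebesgue_on S) (\<lambda>x. e)"
        using that by (intro integrable_lebesgue_on_compact) auto
      show "\<bar>f x - g x\<bar> \<le> e" if "x \<in> space (lebesgue_on S)" for x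
        using that \<open>S \<subseteq> A \<union> B\<close> \<open>\<And>x. x \<in> A \<union> B \<Longrightarrow> \<bar>f x - g x\<bar> < e\<close>[of x]
        by (auto simp: space_restrict_space)
    qed (use i in auto)
    also have "\<dots> = e * measure lebesgue S"
      using S by (simp add: measure_restrict_space space_restrict_space fmeasurableD)
    finally show ?thesis .
  qed
  have "\<bar>?IA f - ?IB f\<bar> \<le> 0 + e" if "0 < e" for e
  proof -
    have m: "0 \<le> m"
      by (simp add: m_def)
    \<comment> \<open>The 1 in the denominator covers the case \<open>m = 0\<close>.\<close>
    define d where "d = e / (m + 1)"
    have d: "0 < d" "d * m \<le> e"
      using that m by (auto simp: d_def field_simps)
    obtain g where g: "g \<in> exp_sums" "\<And>x. x \<in> A \<union> B \<Longrightarrow> \<bar>f x - g x\<bar> < d"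
      using Stone_Weierstrass_basic[OF cont d(1)] by blast
    have "\<bar>?IA f - ?IA g\<bar> \<le> d * measure lebesgue A" "\<bar>?IB f - ?IB g\<bar> \<le> d * measure lebesgue B"
      using g comp by (auto intro!: close)
    then have "\<bar>?IA f - ?IB f\<bar> \<le> d * m"
      using exp_sums_eq[OF g(1)] unfolding m_def distrib_left by linarith
    then show ?thesis
      using d by linarith
  qed
  then have "\<bar>?IA f - ?IB f\<bar> \<le> 0"
    by (rule field_le_epsilon)
  moreover have "?IA f = 0"
    unfolding f_def by (rule integral_eq_zero_AE) (auto simp: space_restrict_space)
  ultimately have "?IB f = 0"
    by simp
  then have "AE x in lebesgue_on B. f x = 0"
    using integral_nonneg_eq_0_iff_AE[OF int(2)[OF cont]] by (simp add: f_def infdist_nonneg)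
  then have "AE x in lebesgue. x \<in> B \<longrightarrow> f x = 0"
    using comp by (subst (asm) AE_restrict_space_iff) (auto simp: lmeasurable_compact fmeasurableD)
  then have "AE x in lebesgue. x \<notin> B - A"
    using in_closed_iff_infdist_zero[OF compact_imp_closed[OF comp(1)] \<open>A \<noteq> {}\<close>]
    by (auto simp: f_def elim!: eventually_mono)
  then show ?thesis
    using comp by (subst negligible_iff_null_sets, subst AE_iff_null_sets)
      (auto simp: lmeasurable_compact fmeasurableD)
qed

section \<open>Equality: convexity and homothety\<close>

text \<open>If a parameter \<open>t\<close> of a segment were missing, the nearest parameters
  \<open>a < t < b\<close> present would exist by closedness, and
  \<open>\<alpha> * a + \<beta> * b\<close> would lie strictly between them.\<close>

lemma closed_ratio_convex_imp_convex:
  fixes S :: "'a::real_normed_vector set"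
  assumes "closed S" and \<alpha>\<beta>: "0 < \<alpha>" "0 < \<beta>" "\<alpha> + \<beta> = 1"
    and comb: "\<And>x y. x \<in> S \<Longrightarrow> y \<in> S \<Longrightarrow> \<alpha> *\<^sub>R x + \<beta> *\<^sub>R y \<in> S"
  shows "convex S"
  unfolding convex_alt
proof (intro ballI allI impI)
  fix x y and t :: real assume xy: "x \<in> S" "y \<in> S" and t: "0 \<le> t \<and> t \<le> 1"
  define \<gamma> where "\<gamma> r = (1 - r) *\<^sub>R x + r *\<^sub>R y" for r :: real
  define T where "T = {0..1} \<inter> \<gamma> -` S"
  have "closed T"
    unfolding T_def \<gamma>_def using \<open>closed S\<close>
    by (intro closed_Int closed_atLeastAtMost continuous_closed_vimage) (auto intro!: continuous_intros)
  have T: "0 \<in> T" "1 \<in> T"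
    using xy by (auto simp: T_def \<gamma>_def)
  have Tcomb: "\<alpha> * r + \<beta> * s \<in> T" if "r \<in> T" "s \<in> T" for r s
  proof -
    have "\<gamma> (\<alpha> * r + \<beta> * s) = ((\<alpha> + \<beta>) - (\<alpha> * r + \<beta> * s)) *\<^sub>R x + (\<alpha> * r + \<beta> * s) *\<^sub>R y"
      by (simp add: \<gamma>_def \<alpha>\<beta>(3))
    also have "\<dots> = \<alpha> *\<^sub>R \<gamma> r + \<beta> *\<^sub>R \<gamma> s"
      by (simp add: \<gamma>_def algebra_simps)
    finally have "\<gamma> (\<alpha> * r + \<beta> * s) \<in> S"
      using comb that by (auto simp: T_def)
    moreover have "\<alpha> * r + \<beta> * s \<le> \<alpha> * 1 + \<beta> * 1"
      using that \<alpha>\<beta> by (intro add_mono mult_left_mono) (auto simp: T_def)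
    moreover have "0 \<le> \<alpha> * r + \<beta> * s"
      using that \<alpha>\<beta> by (auto simp: T_def)
    ultimately show ?thesis
      using \<alpha>\<beta> by (simp add: T_def)
  qed
  have "t \<in> T"
  proof (rule ccontr)
    assume "t \<notin> T"
    define a where "a = Sup (T \<inter> {..t})"
    define b where "b = Inf (T \<inter> {t..})"
    have bdd: "bdd_above (T \<inter> {..t})" "bdd_below (T \<inter> {t..})"
      by (auto simp: T_def intro!: bdd_aboveI[of _ t] bdd_belowI[of _ t])
    have "a \<in> T \<inter> {..t}"
      unfolding a_def using T t \<open>closed T\<close> bdd by (intro closed_contains_Sup closed_Int) auto
    moreover have "b \<in> T \<inter> {t..}"
      unfolding b_def using T t \<open>closed T\<close> bdd by (intro closed_contains_Inf closed_Int) auto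
    ultimately have ab: "a \<in> T" "b \<in> T" "a < t" "t < b"
      using \<open>t \<notin> T\<close> by (auto simp: less_le)
    define c where "c = \<alpha> * a + \<beta> * b"
    have "c = a + \<beta> * (b - a)" "c = b - \<alpha> * (b - a)"
      using \<alpha>\<beta>(3) by (auto simp: c_def algebra_simps simp flip: distrib_right)
    moreover have "0 < \<beta> * (b - a)" "0 < \<alpha> * (b - a)"
      using ab \<alpha>\<beta> by auto
    ultimately have c: "a < c" "c < b" "c \<in> T"
      using Tcomb[OF ab(1,2)] by (auto simp: c_def)
    show False
    proof (cases "c \<le> t")
      case True
      then have "c \<le> a"
        unfolding a_def using c bdd by (intro cSup_upper) auto
      then show False
        using c by simp
    next
      case False
      then have "b \<le> c"
        unfolding b_def using c bdd by (intro cInf_lower) auto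
      then show False
        using c by simp
    qed
  qed
  then show "(1 - t) *\<^sub>R x + t *\<^sub>R y \<in> S"
    by (simp add: T_def \<gamma>_def)
qed

text \<open>The map in \<open>step\<close> is a contraction with fixed point \<open>a\<close>; its
  iterates stay in \<open>S\<close> and converge to \<open>a\<close>.\<close>

lemma closed_absorbing_contraction:
  fixes S :: "'a::real_normed_vector set"
  assumes "closed S" "S \<noteq> {}" "0 \<le> \<beta>" "\<beta> < 1"
    and step: "\<And>y. y \<in> S \<Longrightarrow> (1 - \<beta>) *\<^sub>R a + \<beta> *\<^sub>R y \<in> S"
  shows "a \<in> S"
proof -
  obtain y where "y \<in> S"
    using assms by blast
  have "a + \<beta> ^ k *\<^sub>R (y - a) \<in> S" for k
  proof (induction k)
    case 0
    then show ?case
      using \<open>y \<in> S\<close> by simp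
  next
    case (Suc k)
    have "a + \<beta> ^ Suc k *\<^sub>R (y - a) = (1 - \<beta>) *\<^sub>R a + \<beta> *\<^sub>R (a + \<beta> ^ k *\<^sub>R (y - a))"
      by (simp add: algebra_simps)
    then show ?case
      using step[OF Suc] by simp
  qed
  moreover have "(\<lambda>k. a + \<beta> ^ k *\<^sub>R (y - a)) \<longlonglongrightarrow> a + 0 *\<^sub>R (y - a)"
    using assms by (intro tendsto_intros LIMSEQ_realpow_zero) auto
  ultimately show ?thesis
    using closed_sequentially[OF \<open>closed S\<close>, of "\<lambda>k. a + \<beta> ^ k *\<^sub>R (y - a)" a] by simp
qed

text \<open>The measure support \<open>S\<close> lies in the combination \<open>C\<close> and has
  the same volume, so \<open>C - S\<close> is null. A combination of a point of \<open>A\<close> or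
  \<open>B\<close> with a point of \<open>S\<close> has \<open>C\<close> of positive measure around
  it and so falls back into \<open>S\<close>; the contraction lemma then draws \<open>A\<close> and
  \<open>B\<close> into \<open>S\<close>.\<close>

lemma brunn_minkowski_eq_imp_eq_convex:
  fixes A B :: "'a::euclidean_space set"
  assumes comp: "compact A" "compact B"
    and \<alpha>\<beta>: "0 < \<alpha>" "0 < \<beta>" "\<alpha> + \<beta> = 1"
    and vol: "0 < measure lebesgue A" "measure lebesgue B = measure lebesgue A"
      "measure lebesgue ((*\<^sub>R) \<alpha> ` A + (*\<^sub>R) \<beta> ` B) = measure lebesgue A"
    and null: "negligible (B - A)"
  shows "A = B" and "convex A"
proof -
  let ?\<mu> = "measure (lebesgue :: 'a measure)"
  define C where "C = (*\<^sub>R) \<alpha> ` A + (*\<^sub>R) \<beta> ` B"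
  have compC: "compact C"
    unfolding C_def by (intro compact_set_plus compact_scaleR_image comp)
  have lm: "A \<in> lmeasurable" "B \<in> lmeasurable" "C \<in> lmeasurable" "A \<inter> B \<in> lmeasurable"
    using comp compC by (auto simp: lmeasurable_compact compact_Int)
  have lmb: "X \<inter> ball x r \<in> lmeasurable" if "X \<in> lmeasurable" for X and x :: 'a and r
    using that by (intro fmeasurable.Int) auto
  \<comment> \<open>Since the volumes agree, \<open>null\<close> also makes \<open>A - B\<close>
    null.\<close>
  have "?\<mu> (A \<inter> B) = ?\<mu> A"
    using measurable_measure_Diff[of B lebesgue "A \<inter> B"] lm null vol(2)
    by (simp add: Diff_Int_distrib fmeasurableD negligible_imp_measure0 Diff_Int)
  then have "?\<mu> (A - B) = 0"
    using measurable_measure_Diff[of A lebesgue "A \<inter> B"] lm by (simp add: fmeasurableD Diff_Int)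
  then have null': "negligible (A - B)"
    using lm by (auto simp: negligible_iff_measure intro: fmeasurable.Diff)
  have ball_eq: "?\<mu> (B \<inter> ball x r) = ?\<mu> (A \<inter> ball x r)" for x r
    by (rule measure_negligible_symdiff)
      (use lm null null' in \<open>auto intro: lmb negligible_subset[of "(A - B) \<union> (B - A)"]\<close>)
  \<comment> \<open>The support of Lebesgue measure restricted to \<open>A\<close>, which is also that of \<open>B\<close> and of \<open>C\<close>.\<close>
  define S where "S = {x. \<forall>r>0. 0 < ?\<mu> (A \<inter> ball x r)}"
  have supp: "x \<in> X" if "x \<in> S" "closed X" "\<And>r. ?\<mu> (X \<inter> ball x r) = ?\<mu> (A \<inter> ball x r)" for x X
  proof (rule ccontr)
    assume "x \<notin> X"
    then obtain r where "0 < r" "ball x r \<subseteq> - X"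
      using \<open>closed X\<close> open_contains_ball[of "- X"] by (auto simp: open_Compl)
    then have "X \<inter> ball x r = {}"
      by blast
    then have "?\<mu> (A \<inter> ball x r) = 0"
      using that(3)[of r] by simp
    moreover have "0 < ?\<mu> (A \<inter> ball x r)"
      using that(1) \<open>0 < r\<close> unfolding S_def by blast
    ultimately show False
      by simp
  qed
  have SA: "S \<subseteq> A" and SB: "S \<subseteq> B"
    using supp[OF _ compact_imp_closed[OF comp(1)] refl] supp[OF _ compact_imp_closed[OF comp(2)] ball_eq]
    by blast+
  have "open (- S)"
    unfolding open_contains_ball
  proof
    fix x assume "x \<in> - S"
    then obtain r where r: "0 < r" "?\<mu> (A \<inter> ball x r) \<le> 0"
      by (auto simp: S_def not_less)
    have "ball x r \<subseteq> - S"
    proof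
      fix y assume "y \<in> ball x r"
      then obtain e where e: "0 < e" "ball y e \<subseteq> ball x r"
        by (meson open_ball open_contains_ball)
      then have "?\<mu> (A \<inter> ball y e) \<le> ?\<mu> (A \<inter> ball x r)"
        using lmb[OF lm(1)] by (intro measure_mono_fmeasurable) (auto simp: fmeasurableD)
      then show "y \<in> - S"
        using e r by (auto simp: S_def not_less intro!: exI[of _ e])
    qed
    then show "\<exists>e>0. ball x e \<subseteq> - S"
      using r by blast
  qed
  then have "closed S"
    by (simp add: closed_def)
  \<comment> \<open>Every point of \<open>A - S\<close> has a null neighbourhood in it, and local
    negligibility is global.\<close>
  have nullAS: "negligible (A - S)"
  proof (rule locally_negligible_alt[THEN iffD2], rule ballI)
    fix x assume "x \<in> A - S"
    then obtain r where r: "0 < r" "?\<mu> (A \<inter> ball x r) \<le> 0"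
      by (auto simp: S_def not_less)
    then have "?\<mu> (A \<inter> ball x r) = 0"
      using measure_nonneg[of lebesgue "A \<inter> ball x r"] by linarith
    then have "negligible (A \<inter> ball x r)"
      using lmb[OF lm(1)] by (simp add: negligible_iff_measure)
    then have "negligible ((A - S) \<inter> ball x r)"
      by (rule negligible_subset) auto
    then show "\<exists>U. openin (top_of_set (A - S)) U \<and> x \<in> U \<and> negligible U"
      using \<open>x \<in> A - S\<close> r by (intro exI[of _ "(A - S) \<inter> ball x r"]) auto
  qed
  have "compact S"
    using SA \<open>closed S\<close> comp(1) by (metis compact_Int_closed inf.absorb_iff2)
  then have lmS: "S \<in> lmeasurable"
    by (simp add: lmeasurable_compact)
  have "?\<mu> S = ?\<mu> A"
    using measurable_measure_Diff[of A lebesgue S] lm lmS SA nullAS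
    by (simp add: fmeasurableD negligible_imp_measure0)
  have "S \<subseteq> C"
  proof
    fix x assume "x \<in> S"
    then have "\<alpha> *\<^sub>R x + \<beta> *\<^sub>R x \<in> C"
      using SA SB unfolding C_def by blast
    then show "x \<in> C"
      by (simp add: scaleR_left_distrib[symmetric] \<alpha>\<beta>)
  qed
  then have "?\<mu> (C - S) = 0"
    using measurable_measure_Diff[of C lebesgue S] lm lmS vol(3) \<open>?\<mu> S = ?\<mu> A\<close>
    by (simp add: fmeasurableD C_def)
  then have "negligible (C - S)"
    using lm lmS by (auto simp: negligible_iff_measure intro: fmeasurable.Diff)
  have S_if_pos: "z \<in> S" if "\<And>r. 0 < r \<Longrightarrow> 0 < ?\<mu> (C \<inter> ball z r)" for z
    unfolding S_def
  proof (intro CollectI allI impI)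
    fix r :: real assume "0 < r"
    have "?\<mu> (C \<inter> ball z r) \<le> ?\<mu> ((A \<inter> ball z r) \<union> (C - S))"
      using SA lm lmS lmb
      by (intro measure_mono_fmeasurable) (auto intro: fmeasurable.Un fmeasurable.Diff fmeasurableD)
    also have "\<dots> = ?\<mu> (A \<inter> ball z r)"
      using lmb[OF lm(1)] \<open>negligible (C - S)\<close>
      by (intro measure_Un_null_set) (auto simp: fmeasurableD negligible_iff_null_sets)
    finally show "0 < ?\<mu> (A \<inter> ball z r)"
      using that[OF \<open>0 < r\<close>] by linarith
  qed
  \<comment> \<open>The affine map shrinks a piece of \<open>X\<close> near \<open>y\<close>, of
    positive measure, into \<open>C\<close>; the radius \<open>r / t\<close> becomes
    \<open>r\<close> under scaling by \<open>t\<close>.\<close>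
  have comb_pos: "0 < ?\<mu> (C \<inter> ball (a + t *\<^sub>R y) r)"
    if "0 < t" "y \<in> S" "0 < r" "X \<in> lmeasurable" "(\<lambda>x. t *\<^sub>R x + a) ` X \<subseteq> C"
      "\<And>r. ?\<mu> (X \<inter> ball y r) = ?\<mu> (A \<inter> ball y r)" for a y t r X
  proof -
    let ?f = "\<lambda>x. t *\<^sub>R x + a"
    have "0 < t ^ DIM('a) * ?\<mu> (X \<inter> ball y (r / t))"
      using that by (auto simp: S_def)
    also have "\<dots> = ?\<mu> (?f ` (X \<inter> ball y (r / t)))"
      using measure_lebesgue_affine[of t a "X \<inter> ball y (r / t)"] that by simp
    also have "\<dots> \<le> ?\<mu> (C \<inter> ball (a + t *\<^sub>R y) r)"
    proof (rule measure_mono_fmeasurable)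
      show "?f ` (X \<inter> ball y (r / t)) \<subseteq> C \<inter> ball (a + t *\<^sub>R y) r"
      proof safe
        fix x assume x: "x \<in> X" "x \<in> ball y (r / t)"
        then show "?f x \<in> C"
          using that by blast
        have "dist (a + t *\<^sub>R y) (?f x) = t * dist y x"
          using that by (simp add: dist_norm algebra_simps flip: scaleR_diff_right)
        also have "\<dots> < r"
          using x that by (simp add: field_simps)
        finally show "?f x \<in> ball (a + t *\<^sub>R y) r"
          by simp
      qed
      \<comment> \<open>Measurability of the scaled piece is obtained by writing it as a preimage
        under the inverse scaling.\<close>
      have "(*\<^sub>R) t ` T = (*\<^sub>R) (1 / t) -` T \<inter> space lebesgue" for T :: "'a set"
        using \<open>0 < t\<close> by (force simp: image_iff)
      then have "(*\<^sub>R) t ` (X \<inter> ball y (r / t)) \<in> sets lebesgue"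
        using measurable_sets[OF lebesgue_measurable_scaling fmeasurableD[OF lmb[OF that(4)]]] by metis
      then have "(\<lambda>x. a + x) ` (*\<^sub>R) t ` (X \<inter> ball y (r / t)) \<in> sets lebesgue"
        by (rule lebesgue_sets_translation)
      then show "?f ` (X \<inter> ball y (r / t)) \<in> sets lebesgue"
        by (simp add: image_image add.commute)
    qed (rule lmb[OF lm(3)])
    finally show ?thesis .
  qed
  have step1: "\<alpha> *\<^sub>R x + \<beta> *\<^sub>R y \<in> S" if "x \<in> A" "y \<in> S" for x y
  proof (rule S_if_pos, rule comb_pos)
    show "(\<lambda>z. \<beta> *\<^sub>R z + \<alpha> *\<^sub>R x) ` B \<subseteq> C"
      using that by (auto simp: C_def add.commute[of "\<beta> *\<^sub>R _"])
  qed (use that \<alpha>\<beta> lm ball_eq in auto)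
  have step2: "\<beta> *\<^sub>R x + \<alpha> *\<^sub>R y \<in> S" if "x \<in> B" "y \<in> S" for x y
  proof (rule S_if_pos, rule comb_pos)
    show "(\<lambda>z. \<alpha> *\<^sub>R z + \<beta> *\<^sub>R x) ` A \<subseteq> C"
      using that by (auto simp: C_def)
  qed (use that \<alpha>\<beta> lm in auto)
  have "S \<noteq> {}"
    using \<open>?\<mu> S = ?\<mu> A\<close> vol(1) by auto
  have \<alpha>': "1 - \<beta> = \<alpha>" "1 - \<alpha> = \<beta>"
    using \<alpha>\<beta> by auto
  have "A \<subseteq> S"
  proof
    fix a assume "a \<in> A"
    show "a \<in> S"
    proof (rule closed_absorbing_contraction[OF \<open>closed S\<close> \<open>S \<noteq> {}\<close>])
      show "(1 - \<beta>) *\<^sub>R a + \<beta> *\<^sub>R y \<in> S" if "y \<in> S" for y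
        unfolding \<alpha>' by (rule step1) fact+
    qed (use \<alpha>\<beta> in auto)
  qed
  moreover have "B \<subseteq> S"
  proof
    fix b assume "b \<in> B"
    show "b \<in> S"
    proof (rule closed_absorbing_contraction[OF \<open>closed S\<close> \<open>S \<noteq> {}\<close>])
      show "(1 - \<alpha>) *\<^sub>R b + \<alpha> *\<^sub>R y \<in> S" if "y \<in> S" for y
        unfolding \<alpha>' by (rule step2) fact+
    qed (use \<alpha>\<beta> in auto)
  qed
  ultimately show "A = B"
    using SA SB by blast
  have "convex S"
    using SA step1 by (intro closed_ratio_convex_imp_convex[OF \<open>closed S\<close> \<alpha>\<beta>]) auto
  then show "convex A"
    using \<open>A \<subseteq> S\<close> SA by (metis subset_antisym)
qed

text \<open>Each direction \<open>u\<close> has its own shift \<open>c u\<close>. Integrating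
  \<open>u \<bullet> x\<close> over both sets shows that \<open>c\<close> is linear, given by the
  difference \<open>w\<close> of the centroids, so a single translation removes all shifts.\<close>

lemma brunn_minkowski_eq_translate:
  fixes A B :: "'a::euclidean_space set"
  assumes comp: "compact A" "compact B"
    and \<alpha>\<beta>: "0 < \<alpha>" "0 < \<beta>" "\<alpha> + \<beta> = 1"
    and vol: "0 < measure lebesgue A" "measure lebesgue B = measure lebesgue A"
      "measure lebesgue ((*\<^sub>R) \<alpha> ` A + (*\<^sub>R) \<beta> ` B) = measure lebesgue A"
  obtains w where "B = (+) w ` A" "convex A"
proof -
  let ?\<mu> = "measure (lebesgue :: 'a measure)"
  have "\<exists>c. \<forall>s. ?\<mu> (A \<inter> {x. u \<bullet> x \<le> s}) = ?\<mu> (B \<inter> {x. u \<bullet> x \<le> s + c})" if "u \<noteq> 0" for u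
    using brunn_minkowski_eq_halfspace_measures[OF comp that \<alpha>\<beta> vol] by metis
  then obtain c where c: "\<And>u s. u \<noteq> 0 \<Longrightarrow> ?\<mu> (A \<inter> {x. u \<bullet> x \<le> s}) = ?\<mu> (B \<inter> {x. u \<bullet> x \<le> s + c u})"
    by metis
  define w where "w = ((\<integral>x. x \<partial>lebesgue_on B) - (\<integral>x. x \<partial>lebesgue_on A)) /\<^sub>R ?\<mu> A"
  have int: "integrable (lebesgue_on S) (\<lambda>x. x)" if "compact S" for S :: "'a set"
    using that by (intro integrable_lebesgue_on_compact) auto
  have cw: "c u = u \<bullet> w" if "u \<noteq> 0" for u
  proof -
    have "(\<integral>x. u \<bullet> x \<partial>lebesgue_on A) = (\<integral>x. u \<bullet> x - c u \<partial>lebesgue_on B)"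
      using integral_eq_if_halfspace_measures_eq[OF comp that vol(2)[symmetric] c[OF that], of "\<lambda>x. x"] by simp
    also have "\<dots> = (\<integral>x. u \<bullet> x \<partial>lebesgue_on B) - (\<integral>x. c u \<partial>lebesgue_on B)"
      using comp by (intro Bochner_Integration.integral_diff integrable_lebesgue_on_compact) (auto intro!: continuous_intros)
    also have "(\<integral>x. c u \<partial>lebesgue_on B) = c u * ?\<mu> A"
      using comp vol(2) by (simp add: measure_restrict_space space_restrict_space fmeasurableD lmeasurable_compact)
    finally have "c u * ?\<mu> A = u \<bullet> ((\<integral>x. x \<partial>lebesgue_on B) - (\<integral>x. x \<partial>lebesgue_on A))"
      using int[OF comp(1)] int[OF comp(2)] by (simp add: inner_diff_right)
    moreover have "u \<bullet> w = u \<bullet> ((\<integral>x. x \<partial>lebesgue_on B) - (\<integral>x. x \<partial>lebesgue_on A)) / ?\<mu> A"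
      unfolding w_def inner_scaleR_right divide_inverse by (rule mult.commute)
    ultimately show ?thesis
      using vol(1) by (metis less_irrefl nonzero_mult_div_cancel_right)
  qed
  define B' where "B' = (\<lambda>x. x - w) ` B"
  have compB': "compact B'"
    unfolding B'_def using comp(2) by (rule compact_translation_subtract)
  have volB': "?\<mu> B' = ?\<mu> A"
    by (simp add: B'_def measure_translation_subtract vol(2))
  \<comment> \<open>Translating \<open>B\<close> merely translates the combination, so the volume
    hypothesis carries over to \<open>B'\<close>.\<close>
  have "(*\<^sub>R) \<alpha> ` A + (*\<^sub>R) \<beta> ` B' = (\<lambda>x. x - \<beta> *\<^sub>R w) ` ((*\<^sub>R) \<alpha> ` A + (*\<^sub>R) \<beta> ` B)"
    unfolding B'_def set_plus_image by (force simp: image_iff algebra_simps)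
  then have volsum: "?\<mu> ((*\<^sub>R) \<alpha> ` A + (*\<^sub>R) \<beta> ` B') = ?\<mu> A"
    by (simp add: measure_translation_subtract vol(3))
  have hs: "?\<mu> (A \<inter> {x. u \<bullet> x \<le> s}) = ?\<mu> (B' \<inter> {x. u \<bullet> x \<le> s + 0})" if "u \<noteq> 0" for u s
  proof -
    have "B' \<inter> {x. u \<bullet> x \<le> s} = (\<lambda>x. x - w) ` (B \<inter> {x. u \<bullet> x \<le> s + u \<bullet> w})"
      by (auto simp: B'_def inner_diff_right)
    then show ?thesis
      using c[OF that, of s] cw[OF that] by (simp add: measure_translation_subtract)
  qed
  \<comment> \<open>The direction 0 defines no halfspaces; there the claim is equality of
    volumes.\<close>
  have "(\<integral>x. exp (u \<bullet> x) \<partial>lebesgue_on A) = (\<integral>x. exp (u \<bullet> x) \<partial>lebesgue_on B')" for u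
  proof (cases "u = 0")
    case True
    then show ?thesis
      using comp compB' volB' by (simp add: measure_restrict_space space_restrict_space fmeasurableD lmeasurable_compact)
  next
    case False
    show ?thesis
      using integral_eq_if_halfspace_measures_eq[OF comp(1) compB' False volB'[symmetric] hs[OF False], of exp]
      by simp
  qed
  then have "negligible (B' - A)"
    using vol(1) by (intro negligible_diff_if_exp_integrals_eq[OF comp(1) compB']) auto
  then have "A = B'" "convex A"
    using brunn_minkowski_eq_imp_eq_convex[OF comp(1) compB' \<alpha>\<beta> vol(1) volB' volsum] by auto
  moreover have "B = (+) w ` B'"
    by (auto simp: B'_def image_image)
  ultimately show ?thesis
    using that by metis
qed

text \<open>Both sets are normalised to volume 1, which turns the hypothesis into that of
  \<open>brunn_minkowski_eq_translate\<close>; undoing the scaling turns the translation into a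
  homothety.\<close>

theorem brunn_minkowski_equality:
  fixes A B :: "'a::euclidean_space set"
  assumes comp: "compact A" "compact B" and pos: "0 < measure lebesgue A" "0 < measure lebesgue B"
    and eq: "vroot (A + B) = vroot A + vroot B"
  shows "convex_body A" "homothetic A B"
proof -
  let ?\<mu> = "measure (lebesgue :: 'a measure)"
  define a b where "a = vroot A" and "b = vroot B"
  have ab: "0 < a" "0 < b"
    using pos by (auto simp: a_def b_def)
  define A' B' where "A' = (*\<^sub>R) (1 / a) ` A" and "B' = (*\<^sub>R) (1 / b) ` B"
  \<comment> \<open>With these weights the combination of \<open>A'\<close> and \<open>B'\<close> is
    \<open>A + B\<close> scaled by \<open>1 / (a + b)\<close>.\<close>
  define \<alpha> \<beta> where "\<alpha> = a / (a + b)" and "\<beta> = b / (a + b)"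
  have \<alpha>\<beta>: "0 < \<alpha>" "0 < \<beta>" "\<alpha> + \<beta> = 1"
    using ab by (auto simp: \<alpha>_def \<beta>_def add_divide_distrib[symmetric])
  have comp': "compact A'" "compact B'"
    unfolding A'_def B'_def by (intro compact_scaleR_image comp)+
  have unit: "?\<mu> X = 1" if "vroot X = 1" for X :: "'a set"
    using vroot_power[of X] that by simp
  have vol': "?\<mu> A' = 1" "?\<mu> B' = 1"
    using ab by (auto intro!: unit simp: A'_def B'_def vroot_scaleR simp flip: a_def b_def)
  have "(*\<^sub>R) \<alpha> ` A' + (*\<^sub>R) \<beta> ` B' = (*\<^sub>R) (1 / (a + b)) ` (A + B)"
    using ab unfolding A'_def B'_def \<alpha>_def \<beta>_def set_plus_image
    by (force simp: image_iff scaleR_add_right)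
  then have "vroot ((*\<^sub>R) \<alpha> ` A' + (*\<^sub>R) \<beta> ` B') = 1"
    using ab by (simp only: vroot_scaleR eq) (simp flip: a_def b_def)
  then have volsum: "?\<mu> ((*\<^sub>R) \<alpha> ` A' + (*\<^sub>R) \<beta> ` B') = 1"
    by (rule unit)
  obtain w where w: "B' = (+) w ` A'" "convex A'"
    by (rule brunn_minkowski_eq_translate[OF comp' \<alpha>\<beta>]) (simp_all add: vol' volsum)
  have A: "A = (*\<^sub>R) a ` A'"
    using ab by (simp add: A'_def image_image)
  have B: "B = (*\<^sub>R) b ` B'"
    using ab by (simp add: B'_def image_image)
  have "convex A"
    unfolding A using w(2) by (rule convex_scaling)
  moreover from this have "interior A \<noteq> {}"
    using pos(1) negligible_convex_interior[of A] by (auto dest: negligible_imp_measure0)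
  ultimately show "convex_body A"
    using comp by (simp add: convex_body_def)
  have "B = (\<lambda>x. (b / a) *\<^sub>R x + b *\<^sub>R w) ` A"
    unfolding B w(1) A'_def image_image by (intro image_cong) (auto simp: scaleR_add_right add.commute)
  then show "homothetic A B"
    unfolding homothetic_def using ab by (intro exI[of _ "b / a"] exI[of _ "b *\<^sub>R w"]) auto
qed

section \<open>The inequality for M-sums\<close>

text \<open>The claims share one induction, since adding a summand requires the partial sum to be
  compact and non-empty.\<close>

lemma brunn_minkowski_sum:
  fixes L :: "'i \<Rightarrow> 'a::euclidean_space set"
  assumes "finite J" "\<And>j. j \<in> J \<Longrightarrow> compact (L j)" "\<And>j. j \<in> J \<Longrightarrow> L j \<noteq> {}"
  shows "compact (\<Sum>j\<in>J. L j)" "(\<Sum>j\<in>J. L j) \<noteq> {}" "(\<Sum>j\<in>J. vroot (L j)) \<le> vroot (\<Sum>j\<in>J. L j)"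
proof -
  have "compact (\<Sum>j\<in>J. L j) \<and> (\<Sum>j\<in>J. L j) \<noteq> {} \<and> (\<Sum>j\<in>J. vroot (L j)) \<le> vroot (\<Sum>j\<in>J. L j)"
    using assms
  proof (induction J)
    case empty
    then show ?case
      by (simp add: set_zero)
  next
    case (insert i J)
    then have IH: "compact (\<Sum>j\<in>J. L j)" "(\<Sum>j\<in>J. L j) \<noteq> {}" "(\<Sum>j\<in>J. vroot (L j)) \<le> vroot (\<Sum>j\<in>J. L j)"
      and Li: "compact (L i)" "L i \<noteq> {}"
      by auto
    have "L i + (\<Sum>j\<in>J. L j) \<noteq> {}"
      using IH Li by (auto simp: set_plus_def)
    moreover have "vroot (L i) + vroot (\<Sum>j\<in>J. L j) \<le> vroot (L i + (\<Sum>j\<in>J. L j))"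
      by (intro brunn_minkowski IH Li)
    ultimately show ?case
      using insert.hyps IH Li by (simp add: compact_set_plus)
  qed
  then show "compact (\<Sum>j\<in>J. L j)" "(\<Sum>j\<in>J. L j) \<noteq> {}" "(\<Sum>j\<in>J. vroot (L j)) \<le> vroot (\<Sum>j\<in>J. L j)"
    by auto
qed

text \<open>Strict inequality for one pair would survive the addition of the remaining
  summands.\<close>

lemma brunn_minkowski_sum_equality_pair:
  fixes L :: "'i \<Rightarrow> 'a::euclidean_space set"
  assumes "finite J" "\<And>j. j \<in> J \<Longrightarrow> compact (L j)" "\<And>j. j \<in> J \<Longrightarrow> L j \<noteq> {}"
    and eq: "vroot (\<Sum>j\<in>J. L j) = (\<Sum>j\<in>J. vroot (L j))" and ij: "i \<in> J" "j \<in> J" "i \<noteq> j"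
  shows "vroot (L i + L j) = vroot (L i) + vroot (L j)"
proof -
  define J' where "J' = J - {i, j}"
  have J: "J = insert i (insert j J')" "i \<notin> insert j J'" "j \<notin> J'" "finite J'"
    using ij assms(1) by (auto simp: J'_def)
  have sum: "(\<Sum>k\<in>J. L k) = (L i + L j) + (\<Sum>k\<in>J'. L k)"
    "(\<Sum>k\<in>J. vroot (L k)) = vroot (L i) + vroot (L j) + (\<Sum>k\<in>J'. vroot (L k))"
    using J by (simp_all add: add.assoc)
  have rest: "compact (\<Sum>k\<in>J'. L k)" "(\<Sum>k\<in>J'. L k) \<noteq> {}" "(\<Sum>k\<in>J'. vroot (L k)) \<le> vroot (\<Sum>k\<in>J'. L k)"
    using assms by (intro brunn_minkowski_sum; auto simp: J'_def)+
  have pair: "compact (L i + L j)" "L i + L j \<noteq> {}"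
    using assms(2,3)[OF ij(1)] assms(2,3)[OF ij(2)]
    by (simp add: compact_set_plus, metis ex_in_conv set_plus_intro)
  have "vroot (L i + L j) + vroot (\<Sum>k\<in>J'. L k) \<le> vroot (\<Sum>k\<in>J. L k)"
    unfolding sum by (intro brunn_minkowski pair rest)
  moreover have "vroot (L i) + vroot (L j) \<le> vroot (L i + L j)"
    using assms(2,3) ij by (intro brunn_minkowski) auto
  ultimately show ?thesis
    using eq sum rest by linarith
qed

section \<open>Compactness of M-sums and extremal coefficient vectors\<close>

lemma vol_root_eq_vroot: "vol_root (K :: (real ^ 'n::finite) set) = vroot K"
  by (simp add: vol_root_def)

lemma compact_vec_box:
  fixes K :: "'m::finite \<Rightarrow> 'a::euclidean_space set"
  assumes "\<And>j. compact (K j)"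
  shows "compact {x :: 'a ^ 'm. \<forall>j. x $ j \<in> K j}"
proof -
  have "\<forall>j. \<exists>r. \<forall>y\<in>K j. norm y \<le> r"
    using assms compact_imp_bounded bounded_iff by metis
  then obtain r where r: "\<And>j y. y \<in> K j \<Longrightarrow> norm y \<le> r j"
    by metis
  have "norm x \<le> (\<Sum>j\<in>UNIV. r j)" if "\<forall>j. x $ j \<in> K j" for x :: "'a ^ 'm"
  proof -
    have "norm x \<le> (\<Sum>j\<in>UNIV. norm (x $ j))"
      unfolding norm_vec_def by (intro L2_set_le_sum) auto
    also have "\<dots> \<le> (\<Sum>j\<in>UNIV. r j)"
      using that r by (intro sum_mono) auto
    finally show ?thesis .
  qed
  then have "bounded {x :: 'a ^ 'm. \<forall>j. x $ j \<in> K j}"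
    by (auto simp: bounded_iff)
  moreover have "closed {x :: 'a ^ 'm. \<forall>j. x $ j \<in> K j}"
    using assms closed_vimage_vec_nth[of "K _"] compact_imp_closed
    by (intro closed_Collect_all) (auto simp: vimage_def)
  ultimately show ?thesis
    by (simp add: compact_eq_bounded_closed)
qed

text \<open>Families of points are encoded as vectors of vectors, which makes the M-sum a continuous
  image of a compact product.\<close>

lemma compact_M_sum:
  fixes M :: "(real ^ 'm::finite) set" and K :: "'m \<Rightarrow> (real ^ 'n::finite) set"
  assumes "compact M" "\<And>j. compact (K j)"
  shows "compact (M_sum M K)"
proof -
  have "M_sum M K = (\<lambda>(a, x). \<Sum>j\<in>UNIV. (a $ j) *\<^sub>R (x $ j)) ` (M \<times> {x. \<forall>j. x $ j \<in> K j})"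
  proof (intro equalityI subsetI)
    fix z assume "z \<in> M_sum M K"
    then obtain a x where "a \<in> M" "\<forall>j. x j \<in> K j" "z = (\<Sum>j\<in>UNIV. (a $ j) *\<^sub>R x j)"
      by (auto simp: M_sum_def)
    then show "z \<in> (\<lambda>(a, x). \<Sum>j\<in>UNIV. (a $ j) *\<^sub>R (x $ j)) ` (M \<times> {x. \<forall>j. x $ j \<in> K j})"
      by (intro image_eqI[of _ _ "(a, \<chi> j. x j)"]) auto
  qed (auto simp: M_sum_def)
  moreover have "continuous_on (M \<times> {x. \<forall>j. x $ j \<in> K j})
      (\<lambda>(a, x :: (real ^ 'n) ^ 'm). \<Sum>j\<in>UNIV. (a $ j) *\<^sub>R (x $ j))"
    unfolding case_prod_unfold by (intro continuous_intros)
  ultimately show ?thesis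
    using assms by (simp add: compact_continuous_image compact_Times compact_vec_box)
qed

lemma sum_scaled_subset_M_sum:
  fixes M :: "(real ^ 'm::finite) set" and K :: "'m \<Rightarrow> (real ^ 'n::finite) set"
  assumes "a \<in> M"
  shows "(\<Sum>j\<in>UNIV. (*\<^sub>R) (a $ j) ` K j) \<subseteq> M_sum M K"
proof
  fix z assume "z \<in> (\<Sum>j\<in>UNIV. (*\<^sub>R) (a $ j) ` K j)"
  then obtain s where s: "z = (\<Sum>j\<in>UNIV. s j)" "\<And>j. s j \<in> (*\<^sub>R) (a $ j) ` K j"
    by (auto simp: set_sum_alt)
  then have "\<forall>j. \<exists>x. x \<in> K j \<and> s j = (a $ j) *\<^sub>R x"
    by blast
  then obtain x where "\<And>j. x j \<in> K j" "\<And>j. s j = (a $ j) *\<^sub>R x j"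
    by metis
  then show "z \<in> M_sum M K"
    using assms s by (auto simp: M_sum_def)
qed

text \<open>The halfspace through a maximiser over \<open>M\<close> is convex, so it contains the
  hull as well and the maximum does not grow.\<close>

lemma support_fun_convex_hull_eq_max:
  fixes M :: "'a::euclidean_space set"
  assumes "compact M" "M \<noteq> {}"
  obtains a where "a \<in> M" "support_fun (convex hull M) v = v \<bullet> a"
proof -
  obtain a where a: "a \<in> M" "\<And>y. y \<in> M \<Longrightarrow> v \<bullet> y \<le> v \<bullet> a"
    using continuous_attains_sup[OF assms continuous_on_inner[OF continuous_on_const continuous_on_id], of v]
    by blast
  then have "convex hull M \<subseteq> {y. v \<bullet> y \<le> v \<bullet> a}"
    by (intro hull_minimal) (auto simp: convex_halfspace_le)
  then have "support_fun (convex hull M) v = v \<bullet> a"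
    unfolding support_fun_def using a hull_inc[OF a(1)] by (intro cSup_eq_maximum) auto
  then show ?thesis
    using that a by blast
qed

lemma convex_body_scaleR:
  assumes "convex_body ((*\<^sub>R) c ` K)" "0 < c"
  shows "convex_body K"
proof -
  have K: "K = (*\<^sub>R) (inverse c) ` (*\<^sub>R) c ` K"
    using assms(2) by (simp add: image_image)
  have "compact K" "convex K"
    using assms unfolding convex_body_def by (subst K, blast intro: compact_scaleR_image convex_scaling)+
  moreover have "interior K \<noteq> {}"
    using assms interior_injective_linear_image[of "(*\<^sub>R) c" K]
    by (auto simp: convex_body_def inj_def linear_scaleR_left intro!: linear_scale_self)
  ultimately show ?thesis
    by (simp add: convex_body_def)
qed

lemma homothetic_scaleR:
  fixes K L :: "'a::real_vector set"
  assumes "homothetic ((*\<^sub>R) c ` K) ((*\<^sub>R) d ` L)" "0 < c" "0 < d"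
  shows "homothetic K L"
proof -
  obtain r t where r: "0 < r" and L: "(*\<^sub>R) d ` L = (\<lambda>x. r *\<^sub>R x + t) ` (*\<^sub>R) c ` K"
    using assms by (auto simp: homothetic_def)
  have "L = (*\<^sub>R) (inverse d) ` (*\<^sub>R) d ` L"
    using assms by (simp add: image_image)
  also have "\<dots> = (\<lambda>x. (inverse d * r * c) *\<^sub>R x + inverse d *\<^sub>R t) ` K"
    unfolding L by (simp add: image_image scaleR_add_right mult.assoc)
  finally show ?thesis
    unfolding homothetic_def using assms r
    by (intro exI[of _ "inverse d * r * c"] exI[of _ "inverse d *\<^sub>R t"]) auto
qed

lemma homothetic_refl: "homothetic K K"
  unfolding homothetic_def by (intro exI[of _ 1] exI[of _ 0]) auto

text \<open>The middle term is kept explicit because the equality case needs both inequalities to be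
  tight. Absolute values appear because coefficients may be negative.\<close>

lemma M_sum_lower_bound:
  fixes M :: "(real ^ 'm::finite) set" and K :: "'m \<Rightarrow> (real ^ 'n::finite) set"
  assumes "compact M" "\<And>j. compact (K j)" "\<And>j. K j \<noteq> {}" "a \<in> M"
  shows "(\<Sum>j\<in>UNIV. \<bar>a $ j\<bar> * vol_root (K j)) \<le> vroot (\<Sum>j\<in>UNIV. (*\<^sub>R) (a $ j) ` K j)"
    "vroot (\<Sum>j\<in>UNIV. (*\<^sub>R) (a $ j) ` K j) \<le> vol_root (M_sum M K)"
proof -
  have L: "compact ((*\<^sub>R) (a $ j) ` K j)" "(*\<^sub>R) (a $ j) ` K j \<noteq> {}" for j
    using assms by (auto simp: compact_scaleR_image)
  show "(\<Sum>j\<in>UNIV. \<bar>a $ j\<bar> * vol_root (K j)) \<le> vroot (\<Sum>j\<in>UNIV. (*\<^sub>R) (a $ j) ` K j)"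
    using brunn_minkowski_sum(3)[of UNIV "\<lambda>j. (*\<^sub>R) (a $ j) ` K j", OF finite L]
    unfolding vol_root_eq_vroot vroot_scaleR .
  have "measure lebesgue (\<Sum>j\<in>UNIV. (*\<^sub>R) (a $ j) ` K j) \<le> measure lebesgue (M_sum M K)"
    using assms L
    by (intro measure_mono_fmeasurable[OF sum_scaled_subset_M_sum[OF \<open>a \<in> M\<close>]] fmeasurableD
        lmeasurable_compact brunn_minkowski_sum(1) compact_M_sum) auto
  then show "vroot (\<Sum>j\<in>UNIV. (*\<^sub>R) (a $ j) ` K j) \<le> vol_root (M_sum M K)"
    unfolding vol_root_eq_vroot by (intro real_root_le_mono) auto
qed

theorem corollary7p2:
  fixes M :: "(real ^ 'm::finite) set"
    and K :: "'m \<Rightarrow> (real ^ 'n::finite) set"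
  assumes "CARD('m) \<ge> 2" and "CARD('n) \<ge> 2"
    and "compact M" and "M \<noteq> {}"
    and "\<And>j. compact (K j)" and "\<And>j. K j \<noteq> {}"
  shows "vol_root (M_sum M K) \<ge> support_fun (convex hull M) (\<chi> j. vol_root (K j))
    \<and> ((\<forall>j. measure lebesgue (K j) > 0) \<longrightarrow>
       (\<forall>x. (\<forall>j. x $ j > 0) \<longrightarrow>
          \<not> M \<inter> support_set (convex hull M) x \<subseteq> (\<Union>j. coord_hyperplane j)) \<longrightarrow>
       vol_root (M_sum M K) = support_fun (convex hull M) (\<chi> j. vol_root (K j)) \<longrightarrow>
       (\<forall>j. convex_body (K j)) \<and> (\<forall>i j. homothetic (K i) (K j)))"
proof (intro conjI impI)
  define v where "v = (\<chi> j. vol_root (K j))"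
  have inner_v: "v \<bullet> a = (\<Sum>j\<in>UNIV. a $ j * vol_root (K j))" for a
    by (simp add: v_def inner_vec_def mult.commute)
  have v_nonneg: "0 \<le> vol_root (K j)" for j
    by (simp add: vol_root_def)
  note bound = M_sum_lower_bound[where K = K, OF assms(3,5,6)]
  obtain a where a: "a \<in> M" "support_fun (convex hull M) v = v \<bullet> a"
    using support_fun_convex_hull_eq_max[OF assms(3,4)] by blast
  have inner_v_le: "v \<bullet> a \<le> (\<Sum>j\<in>UNIV. \<bar>a $ j\<bar> * vol_root (K j))" for a
    unfolding inner_v using v_nonneg by (intro sum_mono mult_right_mono) auto
  show "support_fun (convex hull M) (\<chi> j. vol_root (K j)) \<le> vol_root (M_sum M K)"
    using a bound[OF a(1)] inner_v_le[of a] unfolding v_def by linarith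
  assume pos: "\<forall>j. 0 < measure lebesgue (K j)"
    and off: "\<forall>x. (\<forall>j. 0 < x $ j) \<longrightarrow> \<not> M \<inter> support_set (convex hull M) x \<subseteq> (\<Union>j. coord_hyperplane j)"
    and eq: "vol_root (M_sum M K) = support_fun (convex hull M) (\<chi> j. vol_root (K j))"
  have v_pos: "0 < vol_root (K j)" for j
    using pos by (simp add: vol_root_def)
  \<comment> \<open>All volumes are positive, so the facial condition applies to \<open>v\<close>
    and yields a maximiser \<open>b\<close> off all coordinate hyperplanes.\<close>
  then have "\<not> M \<inter> support_set (convex hull M) v \<subseteq> (\<Union>j. coord_hyperplane j)"
    using off by (auto simp: v_def)
  then obtain b where b: "b \<in> M" "v \<bullet> b = support_fun (convex hull M) v" "\<And>j. b $ j \<noteq> 0"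
    by (auto simp: support_set_def coord_hyperplane_def inner_axis')
  define L where "L j = (*\<^sub>R) (b $ j) ` K j" for j
  \<comment> \<open>By \<open>eq\<close> the chain returns to its starting value, so all its terms
    are equal.\<close>
  have chain: "v \<bullet> b \<le> (\<Sum>j\<in>UNIV. \<bar>b $ j\<bar> * vol_root (K j))"
    "(\<Sum>j\<in>UNIV. \<bar>b $ j\<bar> * vol_root (K j)) \<le> vroot (\<Sum>j\<in>UNIV. L j)" "vroot (\<Sum>j\<in>UNIV. L j) \<le> v \<bullet> b"
    using inner_v_le[of b] bound[OF b(1)] eq b(2) by (simp_all add: L_def v_def)
  have "(\<Sum>j\<in>UNIV. (\<bar>b $ j\<bar> - b $ j) * vol_root (K j)) = 0"
    using chain unfolding inner_v by (simp add: left_diff_distrib sum_subtractf)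
  \<comment> \<open>A vanishing sum of nonnegative terms: each coefficient equals its absolute
    value.\<close>
  then have "(\<bar>b $ j\<bar> - b $ j) * vol_root (K j) = 0" for j
    using v_nonneg by (subst (asm) sum_nonneg_eq_0_iff) auto
  then have b_pos: "0 < b $ j" for j
    using v_pos[of j] b(3)[of j] by (metis abs_ge_zero eq_iff_diff_eq_0 less_irrefl mult_eq_0_iff order_le_less)
  have L: "compact (L j)" "L j \<noteq> {}" "0 < measure lebesgue (L j)" for j
    using assms pos b_pos[of j] measure_lebesgue_affine[of "b $ j" 0 "K j"]
    by (auto simp: L_def compact_scaleR_image)
  have "vroot (L j) = \<bar>b $ j\<bar> * vol_root (K j)" for j
    unfolding L_def vroot_scaleR vol_root_eq_vroot ..
  then have "vroot (\<Sum>j\<in>UNIV. L j) = (\<Sum>j\<in>UNIV. vroot (L j))"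
    using chain by simp
  then have "vroot (L i + L j) = vroot (L i) + vroot (L j)" if "i \<noteq> j" for i j
    using brunn_minkowski_sum_equality_pair[of UNIV L i j] L that by simp
  then have pair: "convex_body (L i)" "homothetic (L i) (L j)" if "i \<noteq> j" for i j
    using brunn_minkowski_equality[of "L i" "L j"] L that by auto
  show "\<forall>j. convex_body (K j)"
  proof
    fix i :: 'm
    \<comment> \<open>Convexity comes from equality for a pair, so a second index is
      required.\<close>
    have "card (UNIV :: 'm set) \<noteq> card {i}"
      using assms(1) by simp
    then obtain j where "i \<noteq> j"
      by (metis UNIV_eq_I singleton_iff)
    then show "convex_body (K i)"
      using pair(1) b_pos by (auto simp: L_def intro: convex_body_scaleR)
  qed
  show "\<forall>i j. homothetic (K i) (K j)"
  proof (intro allI)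
    fix i j
    show "homothetic (K i) (K j)"
      using pair(2)[of i j] b_pos homothetic_refl
      by (cases "i = j") (auto simp: L_def intro: homothetic_scaleR)
  qed
qed

end
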